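(* Let $A$ be a ring whose localizations at the maximal ideals are discrete rank one valuation domains. Then $A$ is an SSP-ring if and only if for every ideal $I$ of $A$ the following two conditions hold: (1) for each $n\geq 1$, $V_n(I)\cap \mathrm{Supp}(I)$ is closed in the induced topology of $\mathrm{Supp}(I)$; (2) $V_n(I)\cap \mathrm{Supp}(I)$ is empty for all sufficiently large $n$.
   Context: All rings are commutative with $1$. An ideal $I$ is radical if $\sqrt{I}=I$ (the whole ring counts as a radical ideal). An SSP-ring is a ring in which every ideal is a (finite) product of radical ideals. For an ideal $I$ of $A$ and $n\ge 1$, $V_n(I)=\{P\in\mathrm{Spec}(A): I\subseteq P^n\}$. $\mathrm{Supp}(I)=\{P\in\mathrm{Spec}(A): I_P\ne 0\}$ is the support of $I$ as an $A$-module, with the topology induced from the Zariski topology of $\mathrm{Spec}(A)$. *)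

theory Defs
  imports "HOL-Analysis.Abstract_Topology" "HOL-Algebra.Ideal_Product" "HOL-Algebra.Module"
begin

section \<open>Localization\<close>

text \<open>
  The fraction x/s in the localization of the R-module M at the multiplicative set S, as an
  equivalence class of pairs: x/s = y/t iff u(tx) = u(sy) for some u in S.
\<close>

definition fraction ::
    "('a, 'm) ring_scheme \<Rightarrow> ('a, 'b, 'n) module_scheme \<Rightarrow> 'a set \<Rightarrow> 'b \<Rightarrow> 'a \<Rightarrow> ('b \<times> 'a) set" where
  "fraction R M S x s =
     {(y, t). y \<in> carrier M \<and> t \<in> S \<and>
        (\<exists>u\<in>S. u \<odot>\<^bsub>M\<^esub> (t \<odot>\<^bsub>M\<^esub> x) = u \<odot>\<^bsub>M\<^esub> (s \<odot>\<^bsub>M\<^esub> y))}"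

text \<open>
  The unions below range over all representatives of the arguments; all members of such a union
  coincide. The fields \<open>mult\<close> and \<open>one\<close> are present in every module record but play no role
  in a module.
\<close>

definition module_localization ::
    "('a, 'm) ring_scheme \<Rightarrow> ('a, 'b, 'n) module_scheme \<Rightarrow> 'a set \<Rightarrow>
      (('a \<times> 'a) set, ('b \<times> 'a) set) module" where
  "module_localization R M S =
     \<lparr> carrier = {fraction R M S x s | x s. x \<in> carrier M \<and> s \<in> S},
       mult = undefined,
       one = undefined,
       zero = fraction R M S \<zero>\<^bsub>M\<^esub> \<one>\<^bsub>R\<^esub>,
       add = (\<lambda>p q. \<Union>(x, s)\<in>p. \<Union>(y, t)\<in>q.
                fraction R M S (t \<odot>\<^bsub>M\<^esub> x \<oplus>\<^bsub>M\<^esub> s \<odot>\<^bsub>M\<^esub> y) (s \<otimes>\<^bsub>R\<^esub> t)),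
       smult = (\<lambda>c p. \<Union>(a, u)\<in>c. \<Union>(x, s)\<in>p.
                fraction R M S (a \<odot>\<^bsub>M\<^esub> x) (u \<otimes>\<^bsub>R\<^esub> s)) \<rparr>"

text \<open>An ideal as an R-module; for \<open>I = carrier R\<close> this is R as a module over itself.\<close>

definition ideal_module :: "('a, 'm) ring_scheme \<Rightarrow> 'a set \<Rightarrow> ('a, 'a) module" where
  "ideal_module R I =
     \<lparr> carrier = I, mult = mult R, one = \<one>\<^bsub>R\<^esub>, zero = \<zero>\<^bsub>R\<^esub>, add = add R, smult = mult R \<rparr>"

definition ring_localization :: "('a, 'm) ring_scheme \<Rightarrow> 'a set \<Rightarrow> ('a \<times> 'a) set ring" where
  "ring_localization R S =
     (let M = ideal_module R (carrier R); L = module_localization R M S in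
      \<lparr> carrier = carrier L,
        mult = smult L,
        one = fraction R M S \<one>\<^bsub>R\<^esub> \<one>\<^bsub>R\<^esub>,
        zero = zero L,
        add = add L \<rparr>)"


section \<open>Discrete rank one valuation domains\<close>

definition fraction_field :: "('a, 'm) ring_scheme \<Rightarrow> ('a \<times> 'a) set ring" where
  "fraction_field R = ring_localization R (carrier R - {\<zero>\<^bsub>R\<^esub>})"

definition fraction_field_embedding :: "('a, 'm) ring_scheme \<Rightarrow> 'a \<Rightarrow> ('a \<times> 'a) set" where
  "fraction_field_embedding R r =
     fraction R (ideal_module R (carrier R)) (carrier R - {\<zero>\<^bsub>R\<^esub>}) r \<one>\<^bsub>R\<^esub>"

text \<open>
  The value at zero is conventionally infinite, so \<open>v\<close> is constrained on nonzero elements only.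
  The value group is all of the integers.
\<close>

definition discrete_valuation :: "('k, 'm) ring_scheme \<Rightarrow> ('k \<Rightarrow> int) \<Rightarrow> bool" where
  "discrete_valuation K v \<longleftrightarrow>
     v ` (carrier K - {\<zero>\<^bsub>K\<^esub>}) = UNIV \<and>
     (\<forall>x\<in>carrier K - {\<zero>\<^bsub>K\<^esub>}. \<forall>y\<in>carrier K - {\<zero>\<^bsub>K\<^esub>}. v (x \<otimes>\<^bsub>K\<^esub> y) = v x + v y) \<and>
     (\<forall>x\<in>carrier K - {\<zero>\<^bsub>K\<^esub>}. \<forall>y\<in>carrier K - {\<zero>\<^bsub>K\<^esub>}.
        x \<oplus>\<^bsub>K\<^esub> y \<noteq> \<zero>\<^bsub>K\<^esub> \<longrightarrow> min (v x) (v y) \<le> v (x \<oplus>\<^bsub>K\<^esub> y))"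

definition discrete_valuation_domain :: "('a, 'm) ring_scheme \<Rightarrow> bool" where
  "discrete_valuation_domain R \<longleftrightarrow>
     domain R \<and>
     (\<exists>v. discrete_valuation (fraction_field R) v \<and>
        fraction_field_embedding R ` carrier R =
          {x \<in> carrier (fraction_field R). x \<noteq> \<zero>\<^bsub>fraction_field R\<^esub> \<longrightarrow> 0 \<le> v x})"


section \<open>Prime spectrum and supports\<close>

definition Spec :: "('a, 'm) ring_scheme \<Rightarrow> 'a set set" where
  "Spec R = {P. primeideal P R}"

definition zariski_topology :: "('a, 'm) ring_scheme \<Rightarrow> 'a set topology" where
  "zariski_topology R =
     topology (\<lambda>U. \<exists>E \<subseteq> carrier R. U = Spec R - {P \<in> Spec R. E \<subseteq> P})"

lemma istopology_zariski:
  "istopology (\<lambda>U. \<exists>E \<subseteq> carrier R. U = Spec R - {P \<in> Spec R. E \<subseteq> P})"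
  (is "istopology ?op")
  unfolding istopology_def
proof (intro conjI allI impI)
  fix U V assume "?op U" "?op V"
  then obtain E F where E: "E \<subseteq> carrier R" "U = Spec R - {P \<in> Spec R. E \<subseteq> P}"
    and F: "F \<subseteq> carrier R" "V = Spec R - {P \<in> Spec R. F \<subseteq> P}" by blast
  let ?G = "{e \<otimes>\<^bsub>R\<^esub> f | e f. e \<in> E \<and> f \<in> F} \<inter> carrier R"
  have "?G \<subseteq> P \<longleftrightarrow> E \<subseteq> P \<or> F \<subseteq> P" if "P \<in> Spec R" for P
  proof -
    interpret primeideal P R using that by (simp add: Spec_def)
    show ?thesis
    proof
      assume G: "?G \<subseteq> P"
      show "E \<subseteq> P \<or> F \<subseteq> P"
      proof (rule ccontr)
        assume "\<not> (E \<subseteq> P \<or> F \<subseteq> P)"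
        then obtain e f where ef: "e \<in> E" "e \<notin> P" "f \<in> F" "f \<notin> P" by blast
        then have "e \<in> carrier R" "f \<in> carrier R" using E F by auto
        moreover from this have "e \<otimes>\<^bsub>R\<^esub> f \<in> P" using G ef by blast
        ultimately show False using I_prime ef by blast
      qed
    next
      assume "E \<subseteq> P \<or> F \<subseteq> P"
      then show "?G \<subseteq> P" using E(1) F(1) I_l_closed I_r_closed by blast
    qed
  qed
  then have "U \<inter> V = Spec R - {P \<in> Spec R. ?G \<subseteq> P}" unfolding E F by blast
  then show "?op (U \<inter> V)" by blast
next
  fix K assume "\<forall>U\<in>K. ?op U"
  then have "\<exists>E. \<forall>U\<in>K. E U \<subseteq> carrier R \<and> U = Spec R - {P \<in> Spec R. E U \<subseteq> P}"
    by (intro bchoice)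
  then obtain E where E: "\<forall>U\<in>K. E U \<subseteq> carrier R \<and> U = Spec R - {P \<in> Spec R. E U \<subseteq> P}"
    by (rule exE)
  have "\<Union>K = (\<Union>U\<in>K. Spec R - {P \<in> Spec R. E U \<subseteq> P})"
    using E by (metis (no_types, lifting) SUP_cong image_ident)
  also have "\<dots> = Spec R - {P \<in> Spec R. (\<Union>U\<in>K. E U) \<subseteq> P}" by blast
  finally have "\<Union>K = Spec R - {P \<in> Spec R. (\<Union>U\<in>K. E U) \<subseteq> P}" .
  moreover have "(\<Union>U\<in>K. E U) \<subseteq> carrier R" using E by blast
  ultimately show "?op (\<Union>K)" by blast
qed

definition Supp :: "('a, 'm) ring_scheme \<Rightarrow> ('a, 'b, 'n) module_scheme \<Rightarrow> 'a set set" where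
  "Supp R M =
     {P \<in> Spec R. carrier (module_localization R M (carrier R - P)) \<noteq>
                  {\<zero>\<^bsub>module_localization R M (carrier R - P)\<^esub>}}"

text \<open>The power of P is taken in the monoid of ideals under ideal multiplication.\<close>

definition V_pow :: "('a, 'm) ring_scheme \<Rightarrow> nat \<Rightarrow> 'a set \<Rightarrow> 'a set set" where
  "V_pow R n I = {P \<in> Spec R. I \<subseteq> P [^]\<^bsub>ideals_set R\<^esub> n}"


section \<open>SSP-rings\<close>

definition ideal_radical :: "('a, 'm) ring_scheme \<Rightarrow> 'a set \<Rightarrow> 'a set" where
  "ideal_radical R I = {x \<in> carrier R. \<exists>n::nat. n \<ge> 1 \<and> x [^]\<^bsub>R\<^esub> n \<in> I}"

definition radical_ideal :: "'a set \<Rightarrow> ('a, 'm) ring_scheme \<Rightarrow> bool" where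
  "radical_ideal I R \<longleftrightarrow> ideal I R \<and> ideal_radical R I = I"

text \<open>The empty product is the whole ring, which is itself a radical ideal.\<close>

definition SSP_ring :: "('a, 'm) ring_scheme \<Rightarrow> bool" where
  "SSP_ring R \<longleftrightarrow> cring R \<and>
     (\<forall>I. ideal I R \<longrightarrow>
        (\<exists>Js. (\<forall>J\<in>set Js. radical_ideal J R) \<and> I = foldr (ideal_prod R) Js (carrier R)))"

end

theory Submission
  imports Defs "HOL-Library.Extended_Nat"
begin

text \<open>
  At each maximal ideal \<open>M\<close> the valuation of the localization induces an order function on the
  ring with values in the extended naturals, infinite exactly on the kernel of localization. An
  ideal \<open>I\<close> gets as its order at \<open>M\<close> the least value of its elements. Orders turn products into sums
  (\<open>ord_prod\<close>) and determine the ideal (\<open>ideal_eqI\<close>). Radical ideals have the orders 0, 1 and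
  \<open>\<infinity>\<close> only (\<open>ord_radical\<close>). For \<open>n \<ge> 1\<close> the set \<open>V\<^sub>n(I) \<inter> Supp(I)\<close> consists of the
  maximal ideals at which \<open>I\<close> has a finite order \<open>\<ge> n\<close> (\<open>V_pow_supp_iff\<close>).

  Let \<open>I\<close> be a product of radical ideals. On the support its order at \<open>M\<close> counts the factors
  contained in \<open>M\<close>. This number is bounded by the number of factors, and the primes containing at
  least \<open>n\<close> factors form a closed set.

  Conversely, if both conditions hold, \<open>I\<close> should be the product over \<open>n\<close> of the radical ideals
  that define the closures of \<open>V\<^sub>n(I) \<inter> Supp(I)\<close>, modified so as to vanish outside the support: they
  should have order 1 where \<open>I\<close> has order at least \<open>n\<close>, and 0 on the rest of the support. The
  difficulty is that primes outside the support of \<open>I\<close> might accumulate at a point of the support,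
  which would force the order of such an ideal up. The second condition, applied to
  all ideals, excludes this: an accumulation would produce infinitely many orthogonal nonzero elements
  (\<open>Supp_neighbourhood\<close>), and multiplying the \<open>i\<close>-th of them by the \<open>i\<close>-th power of a local
  uniformizer would give generators of an ideal with finite but unbounded orders
  (\<open>no_infinite_orthogonal_family\<close>). So supports are open, the ideals have the desired orders
  (\<open>ord_level_ideal\<close>), and their product is \<open>I\<close> because it has the same orders.
\<close>

section \<open>Fractions\<close>

locale multiplicative_set = cring R for R (structure) +
  fixes S
  assumes S_carr: "S \<subseteq> carrier R"
    and S_one: "\<one> \<in> S"
    and S_mult: "\<And>s t. s \<in> S \<Longrightarrow> t \<in> S \<Longrightarrow> s \<otimes> t \<in> S"
begin

lemma S_in_carrier [simp]: "s \<in> S \<Longrightarrow> s \<in> carrier R"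
  using S_carr by blast

text \<open>
  Everything about localizations that is used later reduces to this criterion. Its content is that
  the relation between pairs is transitive: if \<open>u\<close> witnesses \<open>a/p = b/q\<close> and \<open>v\<close> witnesses
  \<open>b/q = c/r\<close>, then \<open>u \<otimes> v \<otimes> q\<close> witnesses \<open>a/p = c/r\<close>.
\<close>

lemma fraction_eq_iff:
  assumes "ideal I R" "x \<in> I" "y \<in> I" "s \<in> S" "t \<in> S"
  shows "fraction R (ideal_module R I) S x s = fraction R (ideal_module R I) S y t \<longleftrightarrow>
         (\<exists>u\<in>S. u \<otimes> (t \<otimes> x) = u \<otimes> (s \<otimes> y))"
proof -
  note carr [simp] = ideal.Icarr[OF assms(1)]
  have trans: "\<exists>w\<in>S. w \<otimes> (r \<otimes> a) = w \<otimes> (p \<otimes> c)"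
    if ab: "\<exists>u\<in>S. u \<otimes> (q \<otimes> a) = u \<otimes> (p \<otimes> b)" and bc: "\<exists>v\<in>S. v \<otimes> (r \<otimes> b) = v \<otimes> (q \<otimes> c)"
      and mem: "a \<in> I" "b \<in> I" "c \<in> I" "p \<in> S" "q \<in> S" "r \<in> S" for a b c p q r
  proof -
    obtain u where u: "u \<in> S" "u \<otimes> (q \<otimes> a) = u \<otimes> (p \<otimes> b)" using ab by blast
    obtain v where v: "v \<in> S" "v \<otimes> (r \<otimes> b) = v \<otimes> (q \<otimes> c)" using bc by blast
    have "(u \<otimes> v \<otimes> q) \<otimes> (r \<otimes> a) = (v \<otimes> r) \<otimes> (u \<otimes> (q \<otimes> a))"
      using mem u(1) v(1) by (simp add: m_ac)
    also have "\<dots> = (u \<otimes> p) \<otimes> (v \<otimes> (r \<otimes> b))"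
      unfolding u(2) using mem u(1) v(1) by (simp add: m_ac)
    also have "\<dots> = (u \<otimes> v \<otimes> q) \<otimes> (p \<otimes> c)"
      unfolding v(2) using mem u(1) v(1) by (simp add: m_ac)
    finally show ?thesis using u(1) v(1) mem S_mult by blast
  qed
  have sym: "\<exists>u\<in>S. u \<otimes> (p \<otimes> b) = u \<otimes> (q \<otimes> a)" if "\<exists>u\<in>S. u \<otimes> (q \<otimes> a) = u \<otimes> (p \<otimes> b)" for a b p q
    using that by metis
  show ?thesis
  proof
    assume eq: "fraction R (ideal_module R I) S x s = fraction R (ideal_module R I) S y t"
    have "(y, t) \<in> fraction R (ideal_module R I) S y t"
      using assms S_one by (auto simp: fraction_def ideal_module_def)
    then show "\<exists>u\<in>S. u \<otimes> (t \<otimes> x) = u \<otimes> (s \<otimes> y)"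
      unfolding eq[symmetric] by (auto simp: fraction_def ideal_module_def)
  next
    assume xy: "\<exists>u\<in>S. u \<otimes> (t \<otimes> x) = u \<otimes> (s \<otimes> y)"
    have "(\<exists>u\<in>S. u \<otimes> (r \<otimes> x) = u \<otimes> (s \<otimes> z)) \<longleftrightarrow> (\<exists>u\<in>S. u \<otimes> (r \<otimes> y) = u \<otimes> (t \<otimes> z))"
      if "z \<in> I" "r \<in> S" for z r
      using trans[OF sym[OF xy], of r z] trans[OF xy, of r z] that assms by blast
    then show "fraction R (ideal_module R I) S x s = fraction R (ideal_module R I) S y t"
      by (auto simp: fraction_def ideal_module_def)
  qed
qed

lemma localized_ideal_trivial_iff:
  assumes "ideal I R"
  defines "L \<equiv> module_localization R (ideal_module R I) S"
  shows "carrier L = {\<zero>\<^bsub>L\<^esub>} \<longleftrightarrow> (\<forall>x\<in>I. \<exists>u\<in>S. u \<otimes> x = \<zero>)"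
proof -
  let ?f = "fraction R (ideal_module R I) S"
  interpret ideal I R by fact
  have eq0: "?f x s = ?f \<zero> \<one> \<longleftrightarrow> (\<exists>u\<in>S. u \<otimes> x = \<zero>)" if "x \<in> I" "s \<in> S" for x s
    using fraction_eq_iff[OF assms(1) that(1) zero_closed that(2) S_one] that S_one by auto
  have carr: "carrier L = {?f x s | x s. x \<in> I \<and> s \<in> S}" and zero: "\<zero>\<^bsub>L\<^esub> = ?f \<zero> \<one>"
    by (simp_all add: L_def module_localization_def ideal_module_def)
  have "?f \<zero> \<one> \<in> carrier L" unfolding carr using S_one zero_closed by blast
  then have "carrier L = {\<zero>\<^bsub>L\<^esub>} \<longleftrightarrow> (\<forall>x\<in>I. \<forall>s\<in>S. ?f x s = ?f \<zero> \<one>)"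
    unfolding zero unfolding carr by blast
  also have "\<dots> \<longleftrightarrow> (\<forall>x\<in>I. \<exists>u\<in>S. u \<otimes> x = \<zero>)" using eq0 S_one by blast
  finally show ?thesis .
qed

abbreviation frac where "frac \<equiv> fraction R (ideal_module R (carrier R)) S"

lemma frac_eq_iff:
  assumes "x \<in> carrier R" "y \<in> carrier R" "s \<in> S" "t \<in> S"
  shows "frac x s = frac y t \<longleftrightarrow> (\<exists>u\<in>S. u \<otimes> (t \<otimes> x) = u \<otimes> (s \<otimes> y))"
  using fraction_eq_iff[OF oneideal] assms by blast

lemma frac_self: "x \<in> carrier R \<Longrightarrow> s \<in> S \<Longrightarrow> (x, s) \<in> frac x s"
  using S_one by (auto simp: fraction_def ideal_module_def)

lemma frac_rep:
  assumes "(y, t) \<in> frac x s" 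
  shows "y \<in> carrier R" "t \<in> S" "\<exists>u\<in>S. u \<otimes> (t \<otimes> x) = u \<otimes> (s \<otimes> y)"
  using assms by (auto simp: fraction_def ideal_module_def)

lemma ring_localization_carrier:
  "carrier (ring_localization R S) = {frac x s | x s. x \<in> carrier R \<and> s \<in> S}"
  by (simp add: ring_localization_def module_localization_def Let_def, simp add: ideal_module_def)

lemma ring_localization_zero: "\<zero>\<^bsub>ring_localization R S\<^esub> = frac \<zero> \<one>"
  by (simp add: ring_localization_def module_localization_def Let_def, simp add: ideal_module_def)

lemma ring_localization_one: "\<one>\<^bsub>ring_localization R S\<^esub> = frac \<one> \<one>"
  by (simp add: ring_localization_def Let_def)

text \<open>
  The product is a union over all representatives, so it has to be checked that every pair of
  representatives contributes the same class.
\<close>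

lemma ring_localization_mult:
  assumes "x \<in> carrier R" "y \<in> carrier R" "s \<in> S" "t \<in> S"
  shows "frac x s \<otimes>\<^bsub>ring_localization R S\<^esub> frac y t = frac (x \<otimes> y) (s \<otimes> t)"
proof -
  have rep: "frac (a \<otimes> b) (p \<otimes> q) = frac (x \<otimes> y) (s \<otimes> t)"
    if "(a, p) \<in> frac x s" "(b, q) \<in> frac y t" for a b p q
  proof -
    note A = frac_rep[OF that(1)] and B = frac_rep[OF that(2)]
    obtain u where u: "u \<in> S" "u \<otimes> (p \<otimes> x) = u \<otimes> (s \<otimes> a)" using A by blast
    obtain v where v: "v \<in> S" "v \<otimes> (q \<otimes> y) = v \<otimes> (t \<otimes> b)" using B by blast
    have "(u \<otimes> v) \<otimes> ((s \<otimes> t) \<otimes> (a \<otimes> b)) = (u \<otimes> (s \<otimes> a)) \<otimes> (v \<otimes> (t \<otimes> b))"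
      using A B assms u(1) v(1) by (simp add: m_ac)
    also have "\<dots> = (u \<otimes> v) \<otimes> ((p \<otimes> q) \<otimes> (x \<otimes> y))"
      unfolding u(2)[symmetric] v(2)[symmetric] using A B assms u(1) v(1) by (simp add: m_ac)
    finally show ?thesis
      using A B assms u(1) v(1) S_mult by (subst frac_eq_iff) blast+
  qed
  have "frac x s \<otimes>\<^bsub>ring_localization R S\<^esub> frac y t =
        (\<Union>(a, p)\<in>frac x s. \<Union>(b, q)\<in>frac y t. frac (a \<otimes> b) (p \<otimes> q))"
    by (simp add: ring_localization_def module_localization_def Let_def, simp add: ideal_module_def)
  also have "\<dots> = (\<Union>z\<in>frac x s. \<Union>w\<in>frac y t. frac (x \<otimes> y) (s \<otimes> t))"
    by (intro SUP_cong refl) (auto simp: rep)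
  also have "\<dots> = frac (x \<otimes> y) (s \<otimes> t)"
    using frac_self assms by blast
  finally show ?thesis .
qed

end

section \<open>The order function at a maximal ideal\<close>

text \<open>
  The valuation of the fraction field, restricted to the ring. The ring consists of all fractions of
  nonnegative value, so \<open>v y \<le> v x\<close> puts \<open>x/y\<close> into the ring, which is
  divisibility, and an element of value 1 in the field already lies in the ring.
\<close>

lemma discrete_valuation_domain_order:
  fixes R (structure)
  assumes "discrete_valuation_domain R"
  obtains v :: "'a \<Rightarrow> nat" where
    "\<And>x y. x \<in> carrier R - {\<zero>} \<Longrightarrow> y \<in> carrier R - {\<zero>} \<Longrightarrow> v (x \<otimes> y) = v x + v y"
    "\<And>x y. x \<in> carrier R - {\<zero>} \<Longrightarrow> y \<in> carrier R - {\<zero>} \<Longrightarrow> v y \<le> v x \<Longrightarrow>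
       \<exists>c\<in>carrier R. x = c \<otimes> y"
    "\<exists>t\<in>carrier R - {\<zero>}. v t = 1"
proof -
  define S where "S = carrier R - {\<zero>}"
  let ?K = "ring_localization R S"
  interpret domain R using assms by (simp add: discrete_valuation_domain_def)
  interpret multiplicative_set R S
    by standard (auto simp: S_def integral_iff)
  define e where "e r = frac r \<one>" for r
  obtain w where w: "discrete_valuation ?K w"
    and img: "e ` carrier R = {x \<in> carrier ?K. x \<noteq> \<zero>\<^bsub>?K\<^esub> \<longrightarrow> 0 \<le> w x}"
    using assms unfolding discrete_valuation_domain_def fraction_field_def S_def[symmetric]
      fraction_field_embedding_def e_def by auto
  have SI: "x \<in> S \<longleftrightarrow> x \<in> carrier R \<and> x \<noteq> \<zero>" for x by (auto simp: S_def)
  have eq: "frac x s = frac y t \<longleftrightarrow> t \<otimes> x = s \<otimes> y"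
    if "x \<in> carrier R" "y \<in> carrier R" "s \<in> S" "t \<in> S" for x y s t
  proof -
    have "u \<otimes> (t \<otimes> x) = u \<otimes> (s \<otimes> y) \<longleftrightarrow> t \<otimes> x = s \<otimes> y" if "u \<in> S" for u
      using that \<open>x \<in> _\<close> \<open>y \<in> _\<close> \<open>s \<in> S\<close> \<open>t \<in> S\<close> m_lcancel[of u "t \<otimes> x" "s \<otimes> y"] by (auto simp: SI)
    then show ?thesis using frac_eq_iff[OF that] S_one by blast
  qed
  have nz: "frac x s \<noteq> \<zero>\<^bsub>?K\<^esub>" "frac x s \<in> carrier ?K" if "x \<in> S" "s \<in> S" for x s
  proof -
    show "frac x s \<noteq> \<zero>\<^bsub>?K\<^esub>"
      unfolding ring_localization_zero using that S_one by (subst eq) (auto simp: SI)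
    show "frac x s \<in> carrier ?K" unfolding ring_localization_carrier using that SI by blast
  qed
  have wmult: "w (frac x s \<otimes>\<^bsub>?K\<^esub> frac y t) = w (frac x s) + w (frac y t)"
    if "x \<in> S" "s \<in> S" "y \<in> S" "t \<in> S" for x s y t
    using w nz that unfolding discrete_valuation_def by auto
  have wquot: "w (e x) = w (frac x y) + w (e y)" if "x \<in> S" "y \<in> S" for x y
  proof -
    have "frac x y \<otimes>\<^bsub>?K\<^esub> e y = frac (x \<otimes> y) (y \<otimes> \<one>)"
      unfolding e_def using that S_one by (intro ring_localization_mult) auto
    also have "\<dots> = e x" unfolding e_def
      using that S_one by (subst eq) (auto simp: m_ac S_mult)
    finally show ?thesis using wmult[of x y y \<one>] that S_one by (simp add: e_def)
  qed
  have wpos: "0 \<le> w (e x)" if "x \<in> S" for x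
  proof -
    have "e x \<in> e ` carrier R" using that by simp
    moreover have "e x \<noteq> \<zero>\<^bsub>?K\<^esub>" unfolding e_def using nz that S_one by blast
    ultimately show ?thesis unfolding img by blast
  qed
  have int: "\<exists>c\<in>carrier R. frac x y = e c" if "x \<in> S" "y \<in> S" "0 \<le> w (frac x y)" for x y
  proof -
    have "frac x y \<in> e ` carrier R" unfolding img using that nz(2) by simp
    then show ?thesis by auto
  qed
  show thesis
  proof (rule that[of "\<lambda>x. nat (w (e x))"], unfold S_def[symmetric])
    fix x y assume xy: "x \<in> S" "y \<in> S"
    have "e x \<otimes>\<^bsub>?K\<^esub> e y = e (x \<otimes> y)"
      unfolding e_def using xy S_one by (subst ring_localization_mult) auto
    then have "w (e (x \<otimes> y)) = w (e x) + w (e y)"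
      using wmult[of x \<one> y \<one>] xy S_one by (simp add: e_def)
    then show "nat (w (e (x \<otimes> y))) = nat (w (e x)) + nat (w (e y))"
      using wpos xy by (simp add: nat_add_distrib)
  next
    fix x y assume xy: "x \<in> S" "y \<in> S" and le: "nat (w (e y)) \<le> nat (w (e x))"
    then have "0 \<le> w (frac x y)" using wquot[of x y] wpos[of x] wpos[of y] by simp
    then obtain c where c: "c \<in> carrier R" "frac x y = frac c \<one>" using int xy unfolding e_def by blast
    then have "x = c \<otimes> y" using xy S_one by (subst (asm) eq) (auto simp: m_ac)
    then show "\<exists>c\<in>carrier R. x = c \<otimes> y" using c by blast
  next
    obtain f where f: "f \<in> carrier ?K - {\<zero>\<^bsub>?K\<^esub>}" "w f = 1"
      using w unfolding discrete_valuation_def by (metis UNIV_I imageE)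
    then have "f \<in> e ` carrier R" unfolding img by simp
    then obtain t where t: "t \<in> carrier R" "f = e t" by blast
    then have "t \<in> S" using f(1) by (auto simp: SI e_def ring_localization_zero)
    then show "\<exists>t\<in>S. nat (w (e t)) = 1" using f t by force
  qed
qed

text \<open>
  The kernel of the map from \<open>R\<close> to its localization at \<open>P\<close>.
\<close>

definition localization_kernel :: "('a, 'm) ring_scheme \<Rightarrow> 'a set \<Rightarrow> 'a set" where
  "localization_kernel R P = {x \<in> carrier R. \<exists>u\<in>carrier R - P. u \<otimes>\<^bsub>R\<^esub> x = \<zero>\<^bsub>R\<^esub>}"

lemma (in cring) multiplicative_set_prime_complement:
  "primeideal P R \<Longrightarrow> multiplicative_set R (carrier R - P)"
proof -
  assume "primeideal P R"
  then interpret primeideal P R .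
  show ?thesis
    by standard (use one_imp_carrier I_notcarr I_prime in auto)
qed

text \<open>
  The composite of \<open>R \<rightarrow> R\<^sub>M\<close> with the valuation of \<open>R\<^sub>M\<close>, where the kernel of the first map
  gets the value \<open>\<infinity>\<close>. These five properties are all that the proof retains of the hypothesis
  on the localizations: the fourth one is divisibility in \<open>R\<^sub>M\<close> with denominators cleared, the
  last one provides a uniformizer. The ultrametric inequality follows from them.
\<close>

definition local_order :: "('a, 'm) ring_scheme \<Rightarrow> 'a set \<Rightarrow> ('a \<Rightarrow> enat) \<Rightarrow> bool" where
  "local_order R M v \<longleftrightarrow>
     (\<forall>a\<in>carrier R. v a = \<infinity> \<longleftrightarrow> a \<in> localization_kernel R M) \<and>
     (\<forall>a\<in>carrier R. v a = 0 \<longleftrightarrow> a \<notin> M) \<and>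
     (\<forall>a\<in>carrier R. \<forall>b\<in>carrier R. v (a \<otimes>\<^bsub>R\<^esub> b) = v a + v b) \<and>
     (\<forall>a\<in>carrier R. \<forall>b\<in>carrier R. v b \<le> v a \<longrightarrow>
        (\<exists>s\<in>carrier R - M. \<exists>c\<in>carrier R. s \<otimes>\<^bsub>R\<^esub> a = c \<otimes>\<^bsub>R\<^esub> b)) \<and>
     (\<exists>t\<in>carrier R. v t = 1)"

lemma (in cring) local_order_exists:
  assumes "primeideal M R"
    and "discrete_valuation_domain (ring_localization R (carrier R - M))"
  shows "\<exists>v. local_order R M v"
proof -
  define S where "S = carrier R - M"
  interpret primeideal M R by fact
  interpret multiplicative_set R S
    unfolding S_def by (rule multiplicative_set_prime_complement) fact
  let ?L = "ring_localization R S"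
  interpret L: domain ?L
    using assms(2) unfolding discrete_valuation_domain_def S_def by (rule conjunct1)
  obtain w where
    w_mult: "\<And>x y. x \<in> carrier ?L - {\<zero>\<^bsub>?L\<^esub>} \<Longrightarrow> y \<in> carrier ?L - {\<zero>\<^bsub>?L\<^esub>} \<Longrightarrow>
       w (x \<otimes>\<^bsub>?L\<^esub> y) = w x + (w y :: nat)"
    and w_dvd: "\<And>x y. x \<in> carrier ?L - {\<zero>\<^bsub>?L\<^esub>} \<Longrightarrow> y \<in> carrier ?L - {\<zero>\<^bsub>?L\<^esub>} \<Longrightarrow> w y \<le> w x \<Longrightarrow>
       \<exists>c\<in>carrier ?L. x = c \<otimes>\<^bsub>?L\<^esub> y"
    and w_unif: "\<exists>t\<in>carrier ?L - {\<zero>\<^bsub>?L\<^esub>}. w t = 1"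
    by (rule discrete_valuation_domain_order[OF assms(2)[folded S_def]]) blast
  define e where "e a = frac a \<one>" for a
  define v where "v a = (if e a = \<zero>\<^bsub>?L\<^esub> then \<infinity> else enat (w (e a)))" for a
  have e_carr: "e a \<in> carrier ?L" if "a \<in> carrier R" for a
    unfolding e_def ring_localization_carrier using that S_one by blast
  have e_mult: "e (a \<otimes> b) = e a \<otimes>\<^bsub>?L\<^esub> e b" if "a \<in> carrier R" "b \<in> carrier R" for a b
    unfolding e_def using that S_one by (subst ring_localization_mult) auto
  have frac_e: "frac a s \<otimes>\<^bsub>?L\<^esub> e s = e a" if "a \<in> carrier R" "s \<in> S" for a s
    unfolding e_def using that S_one 
    by (subst ring_localization_mult) (auto simp: frac_eq_iff S_mult m_ac)
  have e_one: "e \<one> = \<one>\<^bsub>?L\<^esub>" by (simp add: e_def ring_localization_one)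
  have kernel: "e a = \<zero>\<^bsub>?L\<^esub> \<longleftrightarrow> a \<in> localization_kernel R M" if "a \<in> carrier R" for a
    unfolding e_def ring_localization_zero localization_kernel_def S_def[symmetric]
    using that S_one by (subst frac_eq_iff) auto
  have mult: "v (a \<otimes> b) = v a + v b" if "a \<in> carrier R" "b \<in> carrier R" for a b
    using that w_mult[of "e a" "e b"] e_carr[of a] e_carr[of b] L.integral_iff[of "e a" "e b"]
    by (auto simp: v_def e_mult)
  have v_one: "v \<one> = 0"
    using mult[of \<one> \<one>] L.one_not_zero by (auto simp: v_def e_one zero_enat_def)
  have v_unit: "v s = 0" if "s \<in> S" for s
  proof -
    have "frac \<one> s \<in> carrier ?L" using that by (auto simp: ring_localization_carrier)
    moreover have "frac \<one> s \<otimes>\<^bsub>?L\<^esub> e s = \<one>\<^bsub>?L\<^esub>" using frac_e that e_one by auto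
    moreover from calculation have "e s \<noteq> \<zero>\<^bsub>?L\<^esub>" "frac \<one> s \<noteq> \<zero>\<^bsub>?L\<^esub>"
      using L.integral_iff[of "frac \<one> s" "e s"] L.one_not_zero e_carr[of s] that by auto
    moreover have "w \<one>\<^bsub>?L\<^esub> = 0" using v_one by (simp add: v_def e_one zero_enat_def)
    ultimately have "w (e s) = 0"
      using w_mult[of "frac \<one> s" "e s"] e_carr[of s] that by auto
    then show ?thesis using \<open>e s \<noteq> _\<close> by (simp add: v_def zero_enat_def)
  qed
  have dvd: "\<exists>s\<in>S. \<exists>c\<in>carrier R. s \<otimes> a = c \<otimes> b"
    if ab: "a \<in> carrier R" "b \<in> carrier R" and le: "v b \<le> v a" for a b
  proof -
    have "\<exists>c\<in>carrier ?L. e a = c \<otimes>\<^bsub>?L\<^esub> e b"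
    proof (cases "e a = \<zero>\<^bsub>?L\<^esub>")
      case True
      then show ?thesis using L.l_null[OF e_carr[OF ab(2)]] by (intro bexI[of _ "\<zero>\<^bsub>?L\<^esub>"]) auto
    next
      case False
      then have "e b \<noteq> \<zero>\<^bsub>?L\<^esub>" "w (e b) \<le> w (e a)" using le by (auto simp: v_def split: if_splits)
      then show ?thesis using w_dvd[of "e a" "e b"] False e_carr ab by auto
    qed
    then obtain c s where c: "c \<in> carrier R" "s \<in> S" "e a = frac c s \<otimes>\<^bsub>?L\<^esub> e b"
      by (auto simp: ring_localization_carrier)
    have "frac c s \<otimes>\<^bsub>?L\<^esub> e b = frac (c \<otimes> b) (s \<otimes> \<one>)"
      unfolding e_def using c(1,2) ab S_one by (intro ring_localization_mult) auto
    then have "frac a \<one> = frac (c \<otimes> b) s" using c by (simp add: e_def)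
    then obtain u where "u \<in> S" "u \<otimes> (s \<otimes> a) = u \<otimes> (\<one> \<otimes> (c \<otimes> b))"
      using c ab S_one by (subst (asm) frac_eq_iff) auto
    then have "(u \<otimes> s) \<otimes> a = (u \<otimes> c) \<otimes> b" using c ab by (simp add: m_assoc)
    then show ?thesis using \<open>u \<in> S\<close> c
      by (intro bexI[of _ "u \<otimes> s"] bexI[of _ "u \<otimes> c"]) (simp_all add: S_mult)
  qed
  have zero_iff: "v a = 0 \<longleftrightarrow> a \<notin> M" if a: "a \<in> carrier R" for a
  proof
    assume "v a = 0"
    then obtain s c where "s \<in> S" "c \<in> carrier R" "s \<otimes> \<one> = c \<otimes> a"
      using dvd[of \<one> a] a v_one by auto
    then show "a \<notin> M" using I_l_closed[of a c] a by (auto simp: S_def)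
  qed (use v_unit a in \<open>simp add: S_def\<close>)
  obtain x where x: "x \<in> carrier ?L" "x \<noteq> \<zero>\<^bsub>?L\<^esub>" "w x = 1" using w_unif by blast
  then obtain t s where t: "t \<in> carrier R" "s \<in> S" "x = frac t s" by (auto simp: ring_localization_carrier)
  have "e s \<noteq> \<zero>\<^bsub>?L\<^esub>" "w (e s) = 0"
    using v_unit[OF t(2)] by (auto simp: v_def zero_enat_def split: if_splits)
  moreover have "e t = x \<otimes>\<^bsub>?L\<^esub> e s" using frac_e t by simp
  ultimately have "v t = 1"
    using w_mult[of x "e s"] x e_carr[of s] t L.integral_iff[of x "e s"] by (auto simp: v_def one_enat_def)
  then have "\<exists>t\<in>carrier R. v t = 1" using t by blast
  moreover have "\<forall>a\<in>carrier R. v a = \<infinity> \<longleftrightarrow> a \<in> localization_kernel R M"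
    using kernel by (auto simp: v_def)
  ultimately have "local_order R M v"
    unfolding local_order_def S_def[symmetric] using mult dvd zero_iff by blast
  then show ?thesis by (intro exI[of _ v])
qed

section \<open>Maximal ideals, supports and products of ideals\<close>

lemma (in cring) ideal_from_closure:
  assumes "I \<subseteq> carrier R" "\<zero> \<in> I"
    and "\<And>a b. a \<in> I \<Longrightarrow> b \<in> I \<Longrightarrow> a \<oplus> b \<in> I"
    and mult: "\<And>a x. a \<in> I \<Longrightarrow> x \<in> carrier R \<Longrightarrow> x \<otimes> a \<in> I"
  shows "ideal I R"
proof (rule idealI)
  show "subgroup I (add_monoid R)"
  proof (rule add.subgroupI)
    show "I \<noteq> {}" using assms(2) by blast
    fix a assume "a \<in> I"
    then have "(\<ominus> \<one>) \<otimes> a \<in> I" using mult by simp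
    moreover have "(\<ominus> \<one>) \<otimes> a = \<ominus> a" using assms(1) \<open>a \<in> I\<close> by (simp add: l_minus subsetD)
    ultimately show "\<ominus> a \<in> I" by simp
  qed (use assms in auto)
  fix a x assume "a \<in> I" "x \<in> carrier R"
  then show "x \<otimes> a \<in> I" "a \<otimes> x \<in> I"
    using mult m_comm[of a x] assms(1) by auto
qed (rule ring_axioms)

lemma (in cring) ideal_in_maximalideal:
  assumes "ideal I R" "\<one> \<notin> I"
  obtains M where "maximalideal M R" "I \<subseteq> M"
proof -
  let ?A = "{J. ideal J R \<and> I \<subseteq> J \<and> \<one> \<notin> J}"
  have "\<exists>M\<in>?A. \<forall>X\<in>?A. M \<subseteq> X \<longrightarrow> X = M"
  proof (rule subset_Zorn_nonempty)
    show "?A \<noteq> {}" using assms by blast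
    fix C assume C: "C \<noteq> {}" "subset.chain ?A C"
    then have A: "J \<in> C \<Longrightarrow> ideal J R \<and> I \<subseteq> J \<and> \<one> \<notin> J" for J
      by (auto simp: subset_chain_def)
    have "ideal (\<Union>C) R"
    proof (rule ideal_from_closure)
      show "\<Union>C \<subseteq> carrier R" using A ideal.Icarr by fastforce
      show "\<zero> \<in> \<Union>C" using A C(1) additive_subgroup.zero_closed ideal.axioms(1) by fast
      fix a assume a: "a \<in> \<Union>C"
      show "a \<oplus> b \<in> \<Union>C" if b: "b \<in> \<Union>C" for b
      proof -
        obtain J where "J \<in> C" "a \<in> J" "b \<in> J"
          using a b C(2) unfolding subset_chain_def by blast
        moreover from this have "a \<oplus> b \<in> J"
          using A by (intro additive_subgroup.a_closed ideal.axioms(1)) auto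
        ultimately show ?thesis by blast
      qed
      show "x \<otimes> a \<in> \<Union>C" if "x \<in> carrier R" for x
      proof -
        obtain J where "J \<in> C" "a \<in> J" using a by blast
        moreover from this have "x \<otimes> a \<in> J" using A that by (intro ideal.I_l_closed) auto
        ultimately show ?thesis by blast
      qed
    qed
    moreover obtain J where "J \<in> C" using C(1) by blast
    ultimately show "\<Union>C \<in> ?A" using A by (intro CollectI conjI) (assumption, fast+)
  qed
  then obtain M where "M \<in> ?A" and *: "\<forall>X\<in>?A. M \<subseteq> X \<longrightarrow> X = M" ..
  then have M: "ideal M R" "I \<subseteq> M" "\<one> \<notin> M"
    and max: "\<And>J. ideal J R \<Longrightarrow> I \<subseteq> J \<Longrightarrow> \<one> \<notin> J \<Longrightarrow> M \<subseteq> J \<Longrightarrow> J = M" by simp_all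
  have "maximalideal M R"
  proof (rule maximalidealI)
    show "carrier R \<noteq> M" using M by blast
    fix J assume "ideal J R" "M \<subseteq> J"
    then show "J = M \<or> J = carrier R" using max[of J] M ideal.one_imp_carrier[of J R] by blast
  qed (rule M)
  then show thesis using M that by blast
qed

text \<open>
  The elements \<open>r\<close> with \<open>r \<otimes> a \<in> I\<close> form an ideal that no maximal ideal contains, so 1 is
  one of them.
\<close>

lemma (in cring) local_global_membership:
  assumes I: "ideal I R" and a: "a \<in> carrier R"
    and local: "\<And>M. maximalideal M R \<Longrightarrow> \<exists>s\<in>carrier R - M. s \<otimes> a \<in> I"
  shows "a \<in> I"
proof (rule ccontr)
  interpret ideal I R by fact
  assume "a \<notin> I"
  have "ideal {r \<in> carrier R. r \<otimes> a \<in> I} R"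
    by (rule ideal_from_closure) (use a I_l_closed in \<open>auto simp: l_distr m_assoc\<close>)
  moreover have "\<one> \<notin> {r \<in> carrier R. r \<otimes> a \<in> I}" using a \<open>a \<notin> I\<close> by simp
  ultimately obtain M where "maximalideal M R" "{r \<in> carrier R. r \<otimes> a \<in> I} \<subseteq> M"
    by (rule ideal_in_maximalideal)
  then show False using local by blast
qed

lemma (in cring) localization_kernel_ideal:
  assumes "primeideal P R"
  shows "ideal (localization_kernel R P) R"
proof -
  interpret multiplicative_set R "carrier R - P"
    using assms by (rule multiplicative_set_prime_complement)
  show ?thesis
  proof (rule ideal_from_closure)
    show "localization_kernel R P \<subseteq> carrier R" "\<zero> \<in> localization_kernel R P"
      using S_one by (auto simp: localization_kernel_def)
    fix a assume "a \<in> localization_kernel R P"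
    then obtain u where u: "a \<in> carrier R" "u \<in> carrier R - P" "u \<otimes> a = \<zero>"
      by (auto simp: localization_kernel_def)
    show "x \<otimes> a \<in> localization_kernel R P" if "x \<in> carrier R" for x
      using u that m_lcomm[of u x a] by (auto simp: localization_kernel_def)
    fix b assume "b \<in> localization_kernel R P"
    then obtain w where w: "b \<in> carrier R" "w \<in> carrier R - P" "w \<otimes> b = \<zero>"
      by (auto simp: localization_kernel_def)
    have "(u \<otimes> w) \<otimes> (a \<oplus> b) = w \<otimes> (u \<otimes> a) \<oplus> u \<otimes> (w \<otimes> b)"
      using u(1,2) w(1,2) by (simp add: r_distr m_ac)
    also have "\<dots> = \<zero>" unfolding u(3) w(3) using u(2) w(2) by simp
    finally show "a \<oplus> b \<in> localization_kernel R P"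
      using u w S_mult unfolding localization_kernel_def by blast
  qed
qed

lemma localization_kernel_subset:
  assumes "primeideal P R"
  shows "localization_kernel R P \<subseteq> P"
proof
  interpret primeideal P R by fact
  fix x assume "x \<in> localization_kernel R P"
  then obtain u where "x \<in> carrier R" "u \<in> carrier R - P" "u \<otimes>\<^bsub>R\<^esub> x \<in> P"
    by (auto simp: localization_kernel_def)
  then show "x \<in> P" using I_prime by blast
qed

lemma localization_kernel_antimono:
  "P \<subseteq> Q \<Longrightarrow> localization_kernel R Q \<subseteq> localization_kernel R P"
  unfolding localization_kernel_def by blast

lemma (in cring) Supp_ideal_iff:
  assumes "ideal I R"
  shows "P \<in> Supp R (ideal_module R I) \<longleftrightarrow> primeideal P R \<and> \<not> I \<subseteq> localization_kernel R P"
proof (cases "primeideal P R")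
  case True
  interpret multiplicative_set R "carrier R - P"
    using True by (rule multiplicative_set_prime_complement)
  have "I \<subseteq> localization_kernel R P \<longleftrightarrow> (\<forall>x\<in>I. \<exists>u\<in>carrier R - P. u \<otimes> x = \<zero>)"
    using ideal.Icarr[OF assms] unfolding localization_kernel_def by blast
  then show ?thesis
    using localized_ideal_trivial_iff[OF assms] True by (auto simp: Supp_def Spec_def)
qed (simp add: Supp_def Spec_def)

lemma (in ring) foldr_ideal_prod_ideal:
  "\<forall>J\<in>set Js. ideal J R \<Longrightarrow> ideal (foldr (ideal_prod R) Js (carrier R)) R"
  by (induction Js) (simp_all add: oneideal ideal_prod_is_ideal)

lemma (in ring) foldr_ideal_prod_subset:
  "\<forall>J\<in>set Js. ideal J R \<Longrightarrow> J \<in> set Js \<Longrightarrow> foldr (ideal_prod R) Js (carrier R) \<subseteq> J"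
proof (induction Js)
  case (Cons J' Js)
  then have "J' \<cdot> foldr (ideal_prod R) Js (carrier R) \<subseteq> J' \<inter> foldr (ideal_prod R) Js (carrier R)"
    by (intro ideal_prod_inter foldr_ideal_prod_ideal) auto
  then show ?case using Cons by auto
qed simp

section \<open>The order of an ideal at a maximal ideal\<close>

definition ideal_order :: "('a \<Rightarrow> enat) \<Rightarrow> 'a set \<Rightarrow> enat" where
  "ideal_order v I = (INF a\<in>I. v a)"

locale local_order_ring = cring R for R (structure) +
  fixes M v
  assumes maximal: "maximalideal M R" and local_order: "local_order R M v"
begin

sublocale M: maximalideal M R by (rule maximal)
sublocale M: primeideal M R by (rule maximalideal_prime) (rule maximal)

abbreviation ord where "ord \<equiv> ideal_order v"

lemma v_infinity_iff: "a \<in> carrier R \<Longrightarrow> v a = \<infinity> \<longleftrightarrow> a \<in> localization_kernel R M"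
  and v_zero_iff: "a \<in> carrier R \<Longrightarrow> v a = 0 \<longleftrightarrow> a \<notin> M"
  and v_mult: "a \<in> carrier R \<Longrightarrow> b \<in> carrier R \<Longrightarrow> v (a \<otimes> b) = v a + v b"
  and v_dvd: "a \<in> carrier R \<Longrightarrow> b \<in> carrier R \<Longrightarrow> v b \<le> v a \<Longrightarrow>
    \<exists>s\<in>carrier R - M. \<exists>c\<in>carrier R. s \<otimes> a = c \<otimes> b"
  and v_uniformizer: "\<exists>t\<in>carrier R. v t = 1"
  using local_order unfolding local_order_def by blast+

lemma one_notin_M: "\<one> \<notin> M"
  using M.one_imp_carrier M.I_notcarr by blast

lemma v_one: "v \<one> = 0"
  using v_zero_iff one_notin_M by blast

lemma v_zero: "v \<zero> = \<infinity>"
  using additive_subgroup.zero_closed[OF ideal.axioms(1)[OF localization_kernel_ideal[OF M.primeideal]]]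
    v_infinity_iff by blast

lemma v_pow: "a \<in> carrier R \<Longrightarrow> v (a [^] (n::nat)) = of_nat n * v a"
  by (induction n) (simp_all add: v_one v_mult distrib_right add.commute)

text \<open>
  If \<open>a\<close> has the smaller value, it divides \<open>b\<close> and hence \<open>a \<oplus> b\<close> in \<open>R\<^sub>M\<close>.
\<close>

lemma v_add:
  assumes "a \<in> carrier R" "b \<in> carrier R" "n \<le> v a" "n \<le> v b"
  shows "n \<le> v (a \<oplus> b)"
proof -
  have key: "v a \<le> v (a \<oplus> b)" if ab: "a \<in> carrier R" "b \<in> carrier R" "v a \<le> v b" for a b
  proof -
    obtain s c where s: "s \<in> carrier R - M" "c \<in> carrier R" "s \<otimes> b = c \<otimes> a"
      using v_dvd[OF ab(2,1,3)] by blast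
    have "v (a \<oplus> b) = v (s \<otimes> (a \<oplus> b))"
      using s ab v_zero_iff[of s] by (simp add: v_mult)
    also have "s \<otimes> (a \<oplus> b) = (s \<oplus> c) \<otimes> a"
      using s ab by (simp add: r_distr l_distr)
    also have "v \<dots> = v (s \<oplus> c) + v a"
      using s ab by (simp add: v_mult)
    finally show ?thesis by simp
  qed
  show ?thesis
  proof (cases "v a \<le> v b")
    case True
    then show ?thesis using key[of a b] assms by (metis order_trans)
  next
    case False
    then show ?thesis using key[of b a] assms by (metis a_comm linear order_trans)
  qed
qed

lemma v_ge_ideal: "ideal {a \<in> carrier R. n \<le> v a} R"
proof (rule ideal_from_closure)
  fix a x assume "a \<in> {a \<in> carrier R. n \<le> v a}" "x \<in> carrier R"
  then show "x \<otimes> a \<in> {a \<in> carrier R. n \<le> v a}"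
    by (simp add: v_mult add_increasing)
qed (auto simp: v_zero v_add)

lemma kernel_prime: "primeideal (localization_kernel R M) R"
proof (rule primeidealI)
  show "carrier R \<noteq> localization_kernel R M"
    using v_infinity_iff[of \<one>] v_one by auto
  fix a b assume "a \<in> carrier R" "b \<in> carrier R" "a \<otimes> b \<in> localization_kernel R M"
  then show "a \<in> localization_kernel R M \<or> b \<in> localization_kernel R M"
    using v_infinity_iff[of "a \<otimes> b"]
    by (simp add: v_mult v_infinity_iff[symmetric] plus_eq_infty_iff_enat)
qed (rule localization_kernel_ideal, rule M.primeideal, rule is_cring)

lemma ord_ge_iff: "n \<le> ord I \<longleftrightarrow> (\<forall>a\<in>I. n \<le> v a)"
  by (auto simp: ideal_order_def le_INF_iff)

lemma ord_le: "a \<in> I \<Longrightarrow> ord I \<le> v a"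
  using ord_ge_iff by blast

lemma ord_attained:
  assumes "ideal I R"
  obtains a where "a \<in> I" "a \<in> carrier R" "v a = ord I"
proof -
  interpret ideal I R by fact
  have "v \<zero> \<in> v ` I" using zero_closed by blast
  then have "ord I \<in> v ` I" unfolding ideal_order_def by (rule wellorder_InfI)
  then show thesis using that Icarr by (auto simp: eq_commute)
qed

lemma ord_infinity_iff:
  assumes "ideal I R"
  shows "ord I = \<infinity> \<longleftrightarrow> I \<subseteq> localization_kernel R M"
proof -
  have "ord I = \<infinity> \<longleftrightarrow> (\<forall>a\<in>I. v a = \<infinity>)" using ord_ge_iff[of \<infinity> I] by simp
  then show ?thesis using v_infinity_iff ideal.Icarr[OF assms] by blast
qed

lemma ord_zero_iff:
  assumes "ideal I R"
  shows "ord I = 0 \<longleftrightarrow> \<not> I \<subseteq> M"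
proof
  assume "ord I = 0"
  then show "\<not> I \<subseteq> M" using ord_attained[OF assms] v_zero_iff by (metis subsetD)
next
  assume "\<not> I \<subseteq> M"
  then obtain a where "a \<in> I" "v a = 0" using v_zero_iff ideal.Icarr[OF assms] by blast
  then show "ord I = 0" using ord_le[of a I] by simp
qed

text \<open>
  The order of an ideal determines its localization: \<open>I\<^sub>M\<close> is generated by any element of \<open>I\<close> of
  least value.
\<close>

lemma local_membership:
  assumes "ideal I R" "a \<in> carrier R" "ord I \<le> v a"
  shows "\<exists>s\<in>carrier R - M. s \<otimes> a \<in> I"
proof -
  obtain b where b: "b \<in> I" "b \<in> carrier R" "v b = ord I" using ord_attained[OF assms(1)] .
  then obtain s c where "s \<in> carrier R - M" "c \<in> carrier R" "s \<otimes> a = c \<otimes> b"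
    using v_dvd[of a b] assms(2,3) by auto
  then show ?thesis using b(1) ideal.I_l_closed[OF assms(1)] by metis
qed

lemma ord_prod:
  assumes "ideal I R" "ideal J R"
  shows "ord (I \<cdot> J) = ord I + ord J"
proof (rule antisym)
  obtain a where a: "a \<in> I" "a \<in> carrier R" "v a = ord I" using ord_attained[OF assms(1)] .
  obtain b where b: "b \<in> J" "b \<in> carrier R" "v b = ord J" using ord_attained[OF assms(2)] .
  show "ord (I \<cdot> J) \<le> ord I + ord J"
    using ord_le[OF ideal_prod.prod[OF a(1) b(1), of R]] a b by (simp add: v_mult)
  have "x \<in> carrier R \<and> ord I + ord J \<le> v x" if "x \<in> I \<cdot> J" for x
    using that
  proof induction
    case (prod i j)
    then show ?case
      using ideal.Icarr[OF assms(1)] ideal.Icarr[OF assms(2)] ord_le[of i I] ord_le[of j J]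
      by (simp add: v_mult add_mono)
  qed (simp add: v_add)
  then show "ord I + ord J \<le> ord (I \<cdot> J)" by (simp add: ord_ge_iff)
qed

lemma ord_carrier: "ord (carrier R) = 0"
  using ord_zero_iff[OF oneideal] one_notin_M by blast

lemma ord_M: "ord M = 1"
proof (rule antisym)
  obtain t where t: "t \<in> carrier R" "v t = 1" using v_uniformizer by blast
  then have "t \<in> M" using v_zero_iff[of t] by auto
  then show "ord M \<le> 1" using ord_le t by metis
  show "1 \<le> ord M"
    using ord_zero_iff[OF M.is_ideal] by (metis ileI1 one_eSuc not_gr_zero order_refl)
qed

text \<open>
  A radical ideal localizes to a radical ideal of the discrete valuation ring \<open>R\<^sub>M\<close>, and the only
  ones are zero, the maximal ideal and the whole ring. The proof takes a uniformizer \<open>t\<close>: if the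
  order of \<open>J\<close> is finite, some \<open>s \<otimes> t\<^sup>k\<close> with \<open>s \<notin> M\<close> lies in \<open>J\<close>, whence
  \<open>s \<otimes> t\<close> does, and its value is 1.
\<close>

lemma ord_radical:
  assumes "radical_ideal J R"
  shows "ord J = (if J \<subseteq> localization_kernel R M then \<infinity> else if J \<subseteq> M then 1 else 0)"
proof -
  have J: "ideal J R" and rad: "ideal_radical R J = J"
    using assms by (auto simp: radical_ideal_def)
  have "ord J \<le> 1" if fin: "ord J \<noteq> \<infinity>"
  proof -
    obtain n where n: "ord J = enat n" using fin by auto
    obtain t where t: "t \<in> carrier R" "v t = 1" using v_uniformizer by blast
    define k where "k = max 1 n"
    have "ord J \<le> v (t [^] k)" using t n by (simp add: v_pow k_def of_nat_eq_enat)
    then obtain s where s: "s \<in> carrier R - M" "s \<otimes> t [^] k \<in> J"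
      using local_membership[OF J] t by blast
    have "(s \<otimes> t) [^] k = s [^] (k - 1) \<otimes> (s \<otimes> t [^] k)"
    proof -
      have "s [^] k = s [^] (k - 1) \<otimes> s" using nat_pow_Suc[of s "k - 1"] by (simp add: k_def)
      then show ?thesis using s t by (simp add: nat_pow_distrib m_assoc)
    qed
    then have "(s \<otimes> t) [^] k \<in> J" using s ideal.I_l_closed[OF J] by simp
    then have "s \<otimes> t \<in> ideal_radical R J"
      using s t unfolding ideal_radical_def k_def by (auto intro!: exI[of _ "max 1 n"])
    then have "ord J \<le> v (s \<otimes> t)" using rad ord_le by blast
    then show ?thesis using s t v_zero_iff[of s] by (simp add: v_mult)
  qed
  moreover have "ord J \<noteq> 0" "ord J \<le> 1 \<Longrightarrow> ord J = 1" if "J \<subseteq> M"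
    using that ord_zero_iff[OF J] by (auto simp: antisym_conv1) (metis ileI1 one_eSuc not_gr_zero antisym)
  ultimately show ?thesis using ord_infinity_iff[OF J] ord_zero_iff[OF J] by auto
qed

lemma ord_foldr_prod:
  assumes "\<forall>J\<in>set Js. ideal J R"
  shows "ord (foldr (ideal_prod R) Js (carrier R)) = sum_list (map ord Js)"
  using assms by (induction Js) (simp_all add: ord_carrier ord_prod foldr_ideal_prod_ideal)

lemma ideal_pow:
  assumes "ideal I R"
  shows "ideal (I [^]\<^bsub>ideals_set R\<^esub> n) R" "ord (I [^]\<^bsub>ideals_set R\<^esub> (n::nat)) = of_nat n * ord I"
proof -
  interpret L: comm_monoid "ideals_set R" by (rule ideals_set_is_comm_monoid)
  have "ideal (I [^]\<^bsub>ideals_set R\<^esub> n) R \<and> ord (I [^]\<^bsub>ideals_set R\<^esub> n) = of_nat n * ord I"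
  proof (induction n)
    case 0
    have "\<one>\<^bsub>ideals_set R\<^esub> = carrier R" by (simp add: ideals_set_def)
    then show ?case by (simp add: oneideal ord_carrier)
  next
    case (Suc n)
    have "I [^]\<^bsub>ideals_set R\<^esub> Suc n = (I [^]\<^bsub>ideals_set R\<^esub> n) \<cdot> I"
      using L.nat_pow_Suc by (simp add: ideals_set_def)
    then show ?case
      using Suc assms by (simp add: ideal_prod_is_ideal ord_prod distrib_right add.commute)
  qed
  then show "ideal (I [^]\<^bsub>ideals_set R\<^esub> n) R" "ord (I [^]\<^bsub>ideals_set R\<^esub> n) = of_nat n * ord I" by auto
qed

text \<open>
  The spectrum of \<open>R\<^sub>M\<close> has just two points: the maximal ideal and zero.
\<close>

lemma prime_below_M:
  assumes P: "primeideal P R" "P \<subseteq> M" "P \<noteq> M"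
  shows "P = localization_kernel R M"
proof
  interpret P: primeideal P R by fact
  show "localization_kernel R M \<subseteq> P"
    using localization_kernel_antimono[OF P(2)] localization_kernel_subset[OF P(1)] by blast
  show "P \<subseteq> localization_kernel R M"
  proof (rule ccontr)
    assume "\<not> P \<subseteq> localization_kernel R M"
    then obtain a where a: "a \<in> P" "a \<in> carrier R" "a \<notin> localization_kernel R M"
      using P.Icarr by blast
    then obtain n where n: "v a = enat n" using v_infinity_iff[of a] by auto
    have "M \<subseteq> P"
    proof
      fix m assume m: "m \<in> M"
      then have mc: "m \<in> carrier R" by (rule M.Icarr)
      have "v m \<noteq> 0" using v_zero_iff mc m by blast
      then have "v a \<le> v (m [^] n)"
        using n mc by (cases "v m") (auto simp: v_pow of_nat_eq_enat zero_enat_def)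
      then obtain s c where s: "s \<in> carrier R - M" "c \<in> carrier R" "s \<otimes> m [^] n = c \<otimes> a"
        using v_dvd[of "m [^] n" a] a mc by blast
      then have "s \<otimes> m [^] n \<in> P" using P.I_l_closed a by simp
      then have pw: "m [^] n \<in> P" using P.I_prime[of s "m [^] n"] s mc P(2) by auto
      have "m [^] k \<in> P \<Longrightarrow> m \<in> P" for k :: nat
      proof (induction k)
        case 0
        then show ?case using P(2) one_notin_M by auto
      qed (use P.I_prime mc in auto)
      then show "m \<in> P" using pw by blast
    qed
    then show False using P by blast
  qed
qed

end

text \<open>
  Membership in a power of \<open>M\<close> is a condition at \<open>M\<close> alone, because \<open>M\<close>, and hence each of its
  powers, is not contained in any other maximal ideal \<open>N\<close> and so has order 0 there.
\<close>

lemma (in cring) mem_power_of_maximal: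
  assumes "\<And>N. maximalideal N R \<Longrightarrow> local_order R N (v N)" and M: "maximalideal M R"
    and a: "a \<in> carrier R"
  shows "a \<in> M [^]\<^bsub>ideals_set R\<^esub> n \<longleftrightarrow> enat n \<le> v M a"
proof -
  have L: "local_order_ring R N (v N)" if "maximalideal N R" for N
    using assms(1) that by (simp add: local_order_ring_def local_order_ring_axioms_def is_cring)
  interpret M: local_order_ring R M "v M" using L M .
  let ?I = "M [^]\<^bsub>ideals_set R\<^esub> n"
  have I: "ideal ?I R" and ordI: "ideal_order (v M) ?I = enat n"
    using M.ideal_pow[OF M.M.is_ideal, of n] M.ord_M by (auto simp: of_nat_eq_enat)
  show ?thesis
  proof
    assume "a \<in> ?I"
    then show "enat n \<le> v M a" using M.ord_le ordI by metis
  next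
    assume le: "enat n \<le> v M a"
    show "a \<in> ?I"
    proof (rule local_global_membership[OF I a])
      fix N assume N: "maximalideal N R"
      interpret N: local_order_ring R N "v N" using L N .
      show "\<exists>s\<in>carrier R - N. s \<otimes> a \<in> ?I"
      proof (cases "N = M")
        case True
        then show ?thesis using M.local_membership[OF I a] le ordI by simp
      next
        case False
        then have "\<not> M \<subseteq> N"
          using M.M.I_maximal[OF N.M.is_ideal] N.M.I_notcarr N.M.Icarr by blast
        then have "ideal_order (v N) ?I = 0"
          using N.ideal_pow[OF M.M.is_ideal, of n] N.ord_zero_iff[OF M.M.is_ideal] by simp
        then show ?thesis using N.local_membership[OF I a] by simp
      qed
    qed
  qed
qed

section \<open>Closed sets of the Zariski topology\<close>

lemma openin_zariski:
  "openin (zariski_topology R) U \<longleftrightarrow> (\<exists>E\<subseteq>carrier R. U = Spec R - {P \<in> Spec R. E \<subseteq> P})"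
  unfolding zariski_topology_def topology_inverse'[OF istopology_zariski] by (rule refl)

lemma (in cring) topspace_zariski: "topspace (zariski_topology R) = Spec R"
proof
  show "topspace (zariski_topology R) \<subseteq> Spec R"
    unfolding topspace_def openin_zariski by blast
  have "Spec R = Spec R - {P \<in> Spec R. {\<one>} \<subseteq> P}"
    using ideal.one_imp_carrier primeideal.I_notcarr primeideal.axioms(1)
    unfolding Spec_def by fastforce
  then have "openin (zariski_topology R) (Spec R)"
    unfolding openin_zariski by (intro exI[of _ "{\<one>}"]) simp
  then show "Spec R \<subseteq> topspace (zariski_topology R)"
    by (rule openin_subset)
qed

lemma (in cring) closedin_zariski:
  "closedin (zariski_topology R) C \<longleftrightarrow> (\<exists>E\<subseteq>carrier R. C = {P \<in> Spec R. E \<subseteq> P})"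
proof -
  have "C \<subseteq> Spec R \<and> Spec R - C = Spec R - V \<longleftrightarrow> C = V" if "V \<subseteq> Spec R" for V
    using that by blast
  then have key: "C = {P \<in> Spec R. E \<subseteq> P} \<longleftrightarrow>
      C \<subseteq> Spec R \<and> Spec R - C = Spec R - {P \<in> Spec R. E \<subseteq> P}" for E
    by simp
  show ?thesis
    unfolding closedin_def topspace_zariski openin_zariski key by (rule iffI; elim conjE exE; intro conjI exI)
qed

text \<open>
  At least \<open>n\<close> members of \<open>J # Js\<close> lie in \<open>P\<close> if and only if \<open>n\<close> members of \<open>Js\<close> do, or
  \<open>J\<close> and \<open>n - 1\<close> members of \<open>Js\<close> do. For \<open>n = 0\<close> the truncated difference is harmless, since
  the first alternative already holds everywhere.
\<close>

lemma (in cring) closedin_count_containing: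
  assumes "\<forall>J\<in>set Js. J \<subseteq> carrier R"
  shows "closedin (zariski_topology R) {P \<in> Spec R. n \<le> length (filter (\<lambda>J. J \<subseteq> P) Js)}"
  using assms
proof (induction Js arbitrary: n)
  case Nil
  have "{P \<in> Spec R. n \<le> length (filter (\<lambda>J. J \<subseteq> P) [])} = (if n = 0 then Spec R else {})" by simp
  then show ?case using closedin_topspace[of "zariski_topology R"] topspace_zariski by auto
next
  case (Cons J Js)
  let ?C = "\<lambda>m. {P \<in> Spec R. m \<le> length (filter (\<lambda>J. J \<subseteq> P) Js)}"
  have "closedin (zariski_topology R) (?C n \<union> ({P \<in> Spec R. J \<subseteq> P} \<inter> ?C (n - 1)))"
    using Cons by (intro closedin_Un closedin_Int) (auto simp: closedin_zariski)
  also have "?C n \<union> ({P \<in> Spec R. J \<subseteq> P} \<inter> ?C (n - 1)) =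
      {P \<in> Spec R. n \<le> length (filter (\<lambda>J. J \<subseteq> P) (J # Js))}"
    by auto
  finally show ?case .
qed

section \<open>Rings that are locally discrete valuation domains\<close>

locale locally_dvr = cring R for R (structure) +
  fixes v :: "'a set \<Rightarrow> 'a \<Rightarrow> enat"
  assumes local_order_ring: "maximalideal M R \<Longrightarrow> local_order_ring R M (v M)"
begin

abbreviation supp where "supp I \<equiv> Supp R (ideal_module R I)"

lemma ideal_eqI:
  assumes "ideal I R" "ideal J R"
    and "\<And>M. maximalideal M R \<Longrightarrow> ideal_order (v M) I = ideal_order (v M) J"
  shows "I = J"
proof -
  have "I \<subseteq> J" if IJ: "ideal I R" "ideal J R"
    and eq: "\<And>M. maximalideal M R \<Longrightarrow> ideal_order (v M) I = ideal_order (v M) J" for I J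
  proof
    fix a assume a: "a \<in> I"
    show "a \<in> J"
    proof (rule local_global_membership[OF IJ(2)])
      show "a \<in> carrier R" using ideal.Icarr[OF IJ(1) a] .
      fix M assume M: "maximalideal M R"
      interpret local_order_ring R M "v M" using local_order_ring M .
      show "\<exists>s\<in>carrier R - M. s \<otimes> a \<in> J"
        using local_membership[OF IJ(2) \<open>a \<in> carrier R\<close>] ord_le[OF a] eq[OF M] by simp
    qed
  qed
  then show ?thesis using assms by (metis subset_antisym)
qed

text \<open>
  A prime \<open>P\<close> that is properly contained in a maximal ideal \<open>M\<close> is the kernel of localization at
  \<open>M\<close> and therefore is contained in the kernel at \<open>P\<close> itself; then \<open>I \<subseteq> P\<close> would make
  \<open>I\<^sub>P\<close> zero.
\<close>

lemma maximal_if_in_supp: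
  assumes "P \<in> supp I" "I \<subseteq> P" "ideal I R"
  shows "maximalideal P R"
proof -
  have P: "primeideal P R" and nK: "\<not> I \<subseteq> localization_kernel R P"
    using assms by (simp_all add: Supp_ideal_iff)
  interpret P: primeideal P R by (rule P)
  have "\<one> \<notin> P" using P.one_imp_carrier P.I_notcarr by blast
  then obtain M where M: "maximalideal M R" "P \<subseteq> M"
    by (rule ideal_in_maximalideal[OF P.is_ideal])
  interpret local_order_ring R M "v M" using local_order_ring M(1) .
  have "P = M"
  proof (rule ccontr)
    assume "P \<noteq> M"
    then have "P = localization_kernel R M" using prime_below_M P M(2) by blast
    then have "P \<subseteq> localization_kernel R P" using localization_kernel_antimono[OF M(2)] by simp
    then show False using assms(2) nK by blast
  qed
  then show ?thesis using M by simp
qed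

lemma ideal_power_subset:
  assumes "ideal I R" "n \<ge> 1"
  shows "I [^]\<^bsub>ideals_set R\<^esub> (n::nat) \<subseteq> I"
proof -
  obtain m where n: "n = Suc m" using assms(2) by (cases n) auto
  interpret L: comm_monoid "ideals_set R" by (rule ideals_set_is_comm_monoid)
  have pow: "J \<in> carrier (ideals_set R) \<longleftrightarrow> ideal J R" for J by (simp add: ideals_set_def)
  have "I [^]\<^bsub>ideals_set R\<^esub> n = (I [^]\<^bsub>ideals_set R\<^esub> m) \<cdot> I"
    using L.nat_pow_Suc by (simp add: n ideals_set_def)
  moreover have "ideal (I [^]\<^bsub>ideals_set R\<^esub> m) R"
    using L.nat_pow_closed[of I m] assms(1) by (simp add: pow)
  ultimately show ?thesis using ideal_prod_inter[of "I [^]\<^bsub>ideals_set R\<^esub> m" I] assms(1) by auto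
qed

lemma local_order_v: "maximalideal M R \<Longrightarrow> local_order R M (v M)"
  by (rule local_order_ring.local_order[OF local_order_ring])

lemma maximal_supp_iff:
  assumes I: "ideal I R" and M: "maximalideal M R"
  shows "M \<in> supp I \<longleftrightarrow> ideal_order (v M) I \<noteq> \<infinity>"
proof -
  interpret local_order_ring R M "v M" using local_order_ring M .
  show ?thesis
    using Supp_ideal_iff[OF I, of M] ord_infinity_iff[OF I] M.primeideal by simp
qed

text \<open>
  Both conditions of the theorem concern these sets, and here they are turned into statements about
  orders: the minimal primes of the support drop out.
\<close>

lemma V_pow_supp_iff:
  assumes I: "ideal I R" and n: "n \<ge> 1"
  shows "P \<in> V_pow R n I \<inter> supp I \<longleftrightarrow>
    maximalideal P R \<and> enat n \<le> ideal_order (v P) I \<and> ideal_order (v P) I \<noteq> \<infinity>"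
proof (cases "maximalideal P R")
  case True
  interpret local_order_ring R P "v P" using local_order_ring True .
  have "a \<in> P [^]\<^bsub>ideals_set R\<^esub> n \<longleftrightarrow> enat n \<le> v P a" if "a \<in> I" for a
    by (rule mem_power_of_maximal[OF local_order_v True ideal.Icarr[OF I that]])
  then have "I \<subseteq> P [^]\<^bsub>ideals_set R\<^esub> n \<longleftrightarrow> (\<forall>a\<in>I. enat n \<le> v P a)"
    by (simp add: subset_iff Ball_def)
  then have "P \<in> V_pow R n I \<longleftrightarrow> enat n \<le> ord I"
    using M.primeideal by (simp add: V_pow_def Spec_def ord_ge_iff)
  then show ?thesis using True maximal_supp_iff[OF I True] by simp
next
  case False
  have "P \<notin> V_pow R n I \<inter> supp I"
  proof
    assume P: "P \<in> V_pow R n I \<inter> supp I"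
    then have "ideal P R" "I \<subseteq> P [^]\<^bsub>ideals_set R\<^esub> n"
      by (auto simp: V_pow_def Spec_def primeideal.axioms(1))
    then have "I \<subseteq> P" using ideal_power_subset[OF _ n] by blast
    then show False using maximal_if_in_supp I P False by blast
  qed
  then show ?thesis using False by blast
qed

section \<open>Products of radical ideals satisfy both conditions\<close>

lemma ord_radical_product:
  assumes M: "maximalideal M R" and Js: "\<forall>J\<in>set Js. radical_ideal J R"
    and fin: "ideal_order (v M) (foldr (ideal_prod R) Js (carrier R)) \<noteq> \<infinity>"
  shows "ideal_order (v M) (foldr (ideal_prod R) Js (carrier R)) =
    enat (length (filter (\<lambda>J. J \<subseteq> M) Js))"
proof -
  interpret local_order_ring R M "v M" using local_order_ring M .
  have ideals: "\<forall>J\<in>set Js. ideal J R" using Js by (auto simp: radical_ideal_def)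
  have "sum_list (map ord Js) \<noteq> \<infinity>"
    using fin ord_foldr_prod[OF ideals] by simp
  then have "sum_list (map ord Js) = enat (length (filter (\<lambda>J. J \<subseteq> M) Js))" using Js
  proof (induction Js)
    case (Cons J Js)
    have "ord J \<noteq> \<infinity>" and tail: "sum_list (map ord Js) \<noteq> \<infinity>"
      using Cons.prems(1) by (simp_all add: plus_eq_infty_iff_enat)
    then have "ord J = (if J \<subseteq> M then 1 else 0)"
      using ord_radical[of J] Cons.prems(2) by (simp split: if_splits)
    moreover have "sum_list (map ord Js) = enat (length (filter (\<lambda>J. J \<subseteq> M) Js))"
      using Cons.IH tail Cons.prems(2) by simp
    ultimately show ?case by (simp add: one_enat_def)
  qed (simp add: zero_enat_def)
  then show ?thesis using ord_foldr_prod[OF ideals] by simp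
qed

lemma V_pow_supp_radical_product:
  assumes I: "ideal I R" and Js: "\<forall>J\<in>set Js. radical_ideal J R"
    and prod: "I = foldr (ideal_prod R) Js (carrier R)" and n: "n \<ge> 1"
  shows "V_pow R n I \<inter> supp I = {P \<in> Spec R. n \<le> length (filter (\<lambda>J. J \<subseteq> P) Js)} \<inter> supp I"
proof (rule Set.set_eqI)
  fix P
  have ideals: "\<forall>J\<in>set Js. ideal J R" using Js by (auto simp: radical_ideal_def)
  have factor: "I \<subseteq> J" if "J \<in> set Js" for J
    unfolding prod using foldr_ideal_prod_subset[OF ideals that] .
  show "P \<in> V_pow R n I \<inter> supp I \<longleftrightarrow>
    P \<in> {P \<in> Spec R. n \<le> length (filter (\<lambda>J. J \<subseteq> P) Js)} \<inter> supp I"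
  proof (cases "maximalideal P R")
    case True
    interpret local_order_ring R P "v P" using local_order_ring True .
    note supp = maximal_supp_iff[OF I True]
    show ?thesis
    proof (cases "ord I = \<infinity>")
      case False
      then have "ord I = enat (length (filter (\<lambda>J. J \<subseteq> P) Js))"
        using ord_radical_product[OF True Js] prod by simp
      then show ?thesis using V_pow_supp_iff[OF I n, of P] True supp M.primeideal by (simp add: Spec_def)
    qed (use supp in simp)
  next
    case False
    have "P \<notin> {P \<in> Spec R. n \<le> length (filter (\<lambda>J. J \<subseteq> P) Js)} \<inter> supp I"
    proof
      assume P: "P \<in> {P \<in> Spec R. n \<le> length (filter (\<lambda>J. J \<subseteq> P) Js)} \<inter> supp I"
      then have "filter (\<lambda>J. J \<subseteq> P) Js \<noteq> []" using n by auto
      then have "\<exists>J\<in>set Js. J \<subseteq> P" by (auto simp: filter_empty_conv)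
      then have "I \<subseteq> P" using factor by blast
      then show False using maximal_if_in_supp I P False by blast
    qed
    then show ?thesis using V_pow_supp_iff[OF I n, of P] False by blast
  qed
qed

section \<open>Boundedness makes supports open\<close>

text \<open>
  Given infinitely many orthogonal nonzero elements \<open>z i\<close>, choose maximal ideals \<open>M i\<close> in their
  supports and elements \<open>t i\<close> of value 1 there. At \<open>M i\<close> all \<open>z j\<close> with \<open>j \<noteq> i\<close> vanish, as
  \<open>R\<close> localizes to a domain, so the ideal generated by all \<open>z i \<otimes> t i ^ i\<close> has a finite order
  \<open>\<ge> i\<close> at \<open>M i\<close>. Its orders are unbounded.
\<close>

lemma no_infinite_orthogonal_family:
  assumes bounded: "\<And>I. ideal I R \<Longrightarrow> \<exists>N. \<forall>n\<ge>N. V_pow R n I \<inter> supp I = {}"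
    and z: "\<And>i::nat. z i \<in> carrier R" "\<And>i. z i \<noteq> \<zero>"
    and orth: "\<And>i j. i \<noteq> j \<Longrightarrow> z i \<otimes> z j = \<zero>"
  shows False
proof -
  have "\<exists>M. maximalideal M R \<and> v M (z i) \<noteq> \<infinity>" for i
  proof (rule ccontr)
    assume *: "\<nexists>M. maximalideal M R \<and> v M (z i) \<noteq> \<infinity>"
    have "z i \<in> {\<zero>}"
    proof (rule local_global_membership[OF zeroideal z(1)])
      fix M assume M: "maximalideal M R"
      interpret local_order_ring R M "v M" using local_order_ring M .
      have "z i \<in> localization_kernel R M" using * M v_infinity_iff[OF z(1)] by blast
      then show "\<exists>s\<in>carrier R - M. s \<otimes> z i \<in> {\<zero>}" by (simp add: localization_kernel_def)
    qed
    then show False using z(2) by simp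
  qed
  then obtain M where M: "\<And>i. maximalideal (M i) R" "\<And>i. v (M i) (z i) \<noteq> \<infinity>" by metis
  have "\<exists>t\<in>carrier R. v (M i) t = 1" for i
    using local_order_ring.v_uniformizer[OF local_order_ring[OF M(1)]] .
  then obtain t where t: "\<And>i. t i \<in> carrier R" "\<And>i. v (M i) (t i) = 1" by metis
  define w where "w i = z i \<otimes> t i [^] i" for i
  have w: "w i \<in> carrier R" for i by (simp add: w_def z t)
  define I where "I = Idl (range w)"
  have I: "ideal I R" unfolding I_def using w by (intro genideal_ideal) blast
  have wI: "w i \<in> I" for i
    unfolding I_def using genideal_self[of "range w"] w by blast
  obtain N where N: "\<And>n. n \<ge> N \<Longrightarrow> V_pow R n I \<inter> supp I = {}" using bounded[OF I] by blast
  define n where "n = max 1 N"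
  interpret local_order_ring R "M n" "v (M n)" using local_order_ring M(1) .
  have vw: "v (M n) (w n) = v (M n) (z n) + enat n"
    using z t by (simp add: w_def v_mult v_pow of_nat_eq_enat)
  have vj: "v (M n) (w j) = \<infinity>" if "j \<noteq> n" for j
  proof -
    have "v (M n) (z j) + v (M n) (z n) = \<infinity>"
      using v_mult[of "z j" "z n"] orth[OF that] z v_zero by simp
    then have "v (M n) (z j) = \<infinity>" using M(2)[of n] by (simp add: plus_eq_infty_iff_enat)
    then show ?thesis using z t by (simp add: w_def v_mult)
  qed
  have "enat n \<le> v (M n) (w j)" for j
    using vj[of j] vw by (cases "j = n") (simp_all add: add_increasing)
  then have "I \<subseteq> {a \<in> carrier R. enat n \<le> v (M n) a}"
    unfolding I_def using w by (intro genideal_minimal v_ge_ideal) blast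
  then have "enat n \<le> ord I" by (auto simp: ord_ge_iff)
  moreover have "ord I \<noteq> \<infinity>"
  proof
    assume "ord I = \<infinity>"
    then have "v (M n) (w n) = \<infinity>" using ord_le[OF wI[of n]] by simp
    then show False using vw M(2)[of n] by (simp add: plus_eq_infty_iff_enat)
  qed
  ultimately have "M n \<in> V_pow R n I \<inter> supp I"
    using V_pow_supp_iff[OF I, of n "M n"] M(1) by (simp add: n_def)
  moreover have "N \<le> n" by (simp add: n_def)
  ultimately show False using N by blast
qed

text \<open>
  The element \<open>y\<close> describes a neighbourhood of \<open>M\<close> inside the support of \<open>x\<close>: at a prime where \<open>x\<close>
  vanishes, some \<open>z\<close> outside the prime kills \<open>x\<close>, and \<open>y \<otimes> z = \<zero>\<close> puts \<open>y\<close> into the prime.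
  If there were no such \<open>y\<close>, then for every \<open>s \<notin> M\<close> some \<open>z\<close> annihilating \<open>x\<close> would have
  \<open>s \<otimes> z \<noteq> \<zero>\<close>. As \<open>x\<close> is nonzero in the domain \<open>R\<^sub>M\<close>, such a \<open>z\<close> vanishes
  there, that is, some \<open>s' \<notin> M\<close> kills it. Replacing \<open>s\<close> by \<open>s \<otimes> s'\<close> and iterating produces an
  infinite orthogonal family.
\<close>

lemma Supp_neighbourhood:
  assumes bounded: "\<And>I. ideal I R \<Longrightarrow> \<exists>N. \<forall>n\<ge>N. V_pow R n I \<inter> supp I = {}"
    and M: "maximalideal M R" and x: "x \<in> carrier R" "x \<notin> localization_kernel R M"
  shows "\<exists>y\<in>carrier R - M. \<forall>z\<in>carrier R. z \<otimes> x = \<zero> \<longrightarrow> y \<otimes> z = \<zero>"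
proof (rule ccontr)
  interpret local_order_ring R M "v M" using local_order_ring M .
  interpret S: multiplicative_set R "carrier R - M"
    by (rule multiplicative_set_prime_complement) (rule M.primeideal)
  assume none: "\<not> ?thesis"
  have step: "\<exists>z s'. z \<in> carrier R \<and> s \<otimes> z \<noteq> \<zero> \<and> s' \<in> carrier R - M \<and> s' \<otimes> z = \<zero>"
    if s: "s \<in> carrier R - M" for s
  proof -
    obtain z where z: "z \<in> carrier R" "z \<otimes> x = \<zero>" "s \<otimes> z \<noteq> \<zero>" using none s by blast
    have "v M z + v M x = \<infinity>" using v_mult[of z x] z x v_zero by simp
    then have "z \<in> localization_kernel R M"
      using x z v_infinity_iff by (auto simp: plus_eq_infty_iff_enat)
    then show ?thesis using z unfolding localization_kernel_def by blast
  qed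
  \<comment> \<open>In each pair the second component is the next orthogonal element; the first component kills it
    and all earlier ones, and the later orthogonal elements are multiples of it.\<close>
  have "\<exists>g. \<forall>n. (fst (g n) \<in> carrier R - M \<and> snd (g n) \<in> carrier R \<and> snd (g n) \<noteq> \<zero> \<and>
        fst (g n) \<otimes> snd (g n) = \<zero>) \<and>
      (\<exists>r\<in>carrier R - M. fst (g (Suc n)) = fst (g n) \<otimes> r) \<and>
      (\<exists>z\<in>carrier R. snd (g (Suc n)) = fst (g n) \<otimes> z)"
  proof (rule dependent_nat_choice)
    obtain z s' where "z \<in> carrier R" "\<one> \<otimes> z \<noteq> \<zero>" "s' \<in> carrier R - M" "s' \<otimes> z = \<zero>"
      using step[OF S.S_one] by blast
    then show "\<exists>g. fst g \<in> carrier R - M \<and> snd g \<in> carrier R \<and> snd g \<noteq> \<zero> \<and> fst g \<otimes> snd g = \<zero>"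
      by (intro exI[of _ "(s', z)"]) auto
  next
    fix g and n :: nat
    assume g: "fst g \<in> carrier R - M \<and> snd g \<in> carrier R \<and> snd g \<noteq> \<zero> \<and> fst g \<otimes> snd g = \<zero>"
    obtain z s' where z: "z \<in> carrier R" "fst g \<otimes> z \<noteq> \<zero>" "s' \<in> carrier R - M" "s' \<otimes> z = \<zero>"
      using step[of "fst g"] g by blast
    have "(fst g \<otimes> s') \<otimes> (fst g \<otimes> z) = (fst g \<otimes> fst g) \<otimes> (s' \<otimes> z)"
      using g z(1,3) by (simp add: m_ac)
    then have "(fst g \<otimes> s') \<otimes> (fst g \<otimes> z) = \<zero>" using g z by simp
    moreover have "fst g \<otimes> s' \<in> carrier R - M" using S.S_mult g z(3) by blast
    ultimately show "\<exists>h. (fst h \<in> carrier R - M \<and> snd h \<in> carrier R \<and> snd h \<noteq> \<zero> \<and>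
        fst h \<otimes> snd h = \<zero>) \<and> (\<exists>r\<in>carrier R - M. fst h = fst g \<otimes> r) \<and>
        (\<exists>z\<in>carrier R. snd h = fst g \<otimes> z)"
      using g z by (intro exI[of _ "(fst g \<otimes> s', fst g \<otimes> z)"]) auto
  qed
  then obtain g where g: "\<And>n::nat. fst (g n) \<in> carrier R - M" "\<And>n. snd (g n) \<in> carrier R"
      "\<And>n. snd (g n) \<noteq> \<zero>" "\<And>n. fst (g n) \<otimes> snd (g n) = \<zero>"
    and gs: "\<And>n. \<exists>r\<in>carrier R - M. fst (g (Suc n)) = fst (g n) \<otimes> r"
      "\<And>n. \<exists>z\<in>carrier R. snd (g (Suc n)) = fst (g n) \<otimes> z"
    by metis
  have kill: "fst (g (i + k)) \<otimes> snd (g i) = \<zero>" for i k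
  proof (induction k)
    case (Suc k)
    obtain r where r: "r \<in> carrier R - M" "fst (g (Suc (i + k))) = fst (g (i + k)) \<otimes> r"
      using gs(1)[of "i + k"] by blast
    have "fst (g (i + k)) \<otimes> r \<otimes> snd (g i) = r \<otimes> (fst (g (i + k)) \<otimes> snd (g i))"
      using g(1)[of "i + k"] g(2)[of i] r(1) by (simp add: m_ac)
    then show ?case using Suc r by simp
  qed (simp add: g(4))
  have orth: "snd (g i) \<otimes> snd (g j) = \<zero>" if ij: "i < j" for i j
  proof -
    obtain k where k: "j = Suc (i + k)" using less_imp_Suc_add[OF ij] by blast
    obtain z where z: "z \<in> carrier R" "snd (g j) = fst (g (i + k)) \<otimes> z"
      using gs(2)[of "i + k"] k by blast
    have "snd (g i) \<otimes> (fst (g (i + k)) \<otimes> z) = (fst (g (i + k)) \<otimes> snd (g i)) \<otimes> z"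
      using g(1)[of "i + k"] g(2)[of i] z(1) by (simp add: m_ac)
    then show ?thesis using kill[of i k] z by simp
  qed
  show False
  proof (rule no_infinite_orthogonal_family[OF bounded, of "\<lambda>i. snd (g i)"])
    fix i j :: nat assume "i \<noteq> j"
    then show "snd (g i) \<otimes> snd (g j) = \<zero>"
      using orth[of i j] orth[of j i] m_comm[OF g(2) g(2), of i j] by (cases "i < j") auto
  qed (use g in auto)
qed

section \<open>Ideals as products of their level ideals\<close>

text \<open>
  The intersection of \<open>V\<^sub>n(I) \<inter> Supp(I)\<close> with all the primes outside the support of \<open>I\<close>. The latter
  force the ideal to vanish wherever \<open>I\<close> does.
\<close>

definition level_ideal :: "'a set \<Rightarrow> nat \<Rightarrow> 'a set" where
  "level_ideal I n = {a \<in> carrier R. \<forall>P\<in>Spec R. (P \<in> supp I \<longrightarrow> P \<in> V_pow R n I) \<longrightarrow> a \<in> P}"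

lemma level_ideal_radical: "radical_ideal (level_ideal I n) R"
proof -
  have "ideal (level_ideal I n) R"
  proof (rule ideal_from_closure)
    fix a b assume "a \<in> level_ideal I n" "b \<in> level_ideal I n"
    then show "a \<oplus> b \<in> level_ideal I n"
      unfolding level_ideal_def Spec_def
      by (auto intro: additive_subgroup.a_closed[OF ideal.axioms(1)[OF primeideal.axioms(1)]])
  next
    fix a x assume "a \<in> level_ideal I n" "x \<in> carrier R"
    then show "x \<otimes> a \<in> level_ideal I n"
      unfolding level_ideal_def Spec_def
      by (auto intro: ideal.I_l_closed[OF primeideal.axioms(1)])
  qed (auto simp: level_ideal_def Spec_def
        intro: additive_subgroup.zero_closed[OF ideal.axioms(1)[OF primeideal.axioms(1)]])
  moreover have "x \<in> P" if "primeideal P R" "x \<in> carrier R" "x [^] k \<in> P" for x P and k :: nat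
  proof -
    interpret P: primeideal P R by fact
    have "\<one> \<notin> P" using P.one_imp_carrier P.I_notcarr by blast
    then show ?thesis using that(3) P.I_prime \<open>x \<in> carrier R\<close> by (induction k) auto
  qed
  then have "ideal_radical R (level_ideal I n) = level_ideal I n"
    unfolding ideal_radical_def level_ideal_def Spec_def by (auto intro!: exI[of _ "1::nat"])
  ultimately show ?thesis by (simp add: radical_ideal_def)
qed

lemma subset_level_ideal:
  assumes "ideal I R" "n \<ge> 1"
  shows "I \<subseteq> level_ideal I n"
proof -
  have "I \<subseteq> P" if P: "P \<in> Spec R" "P \<in> supp I \<longrightarrow> P \<in> V_pow R n I" for P
  proof -
    have prime: "primeideal P R" using P by (simp add: Spec_def)
    show ?thesis
    proof (cases "P \<in> supp I")
      case True
      then have "I \<subseteq> P [^]\<^bsub>ideals_set R\<^esub> n" using P by (simp add: V_pow_def)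
      then show ?thesis using ideal_power_subset[OF primeideal.axioms(1)[OF prime] assms(2)] by blast
    next
      case False
      then show ?thesis
        using Supp_ideal_iff[OF assms(1)] prime localization_kernel_subset[OF prime] by blast
    qed
  qed
  then show ?thesis unfolding level_ideal_def using ideal.Icarr[OF assms(1)] by blast
qed

text \<open>
  The level ideal is radical, so its order at \<open>M\<close> is 0, 1 or \<open>\<infinity>\<close>. It contains \<open>I\<close>, which gives
  a finite order wherever \<open>I\<close> has one. The remaining point is that a maximal ideal \<open>M\<close> of the support
  that contains the level ideal belongs to \<open>V\<^sub>n(I)\<close>, in other words that the primes being intersected
  form a closed set near \<open>M\<close>. Away from \<open>V\<^sub>n(I)\<close> the closedness hypothesis yields an \<open>e \<notin> M\<close>
  lying in all primes of \<open>V\<^sub>n(I) \<inter> Supp(I)\<close>, the openness of supports yields a \<open>y \<notin> M\<close> lying in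
  all primes outside the support, and \<open>e \<otimes> y\<close> lies in all of them.
\<close>

lemma ord_level_ideal:
  assumes bounded: "\<And>I. ideal I R \<Longrightarrow> \<exists>N. \<forall>n\<ge>N. V_pow R n I \<inter> supp I = {}"
    and closed: "closedin (subtopology (zariski_topology R) (supp I)) (V_pow R n I \<inter> supp I)"
    and I: "ideal I R" and n: "n \<ge> 1" and M: "maximalideal M R"
  shows "ideal_order (v M) (level_ideal I n) =
    (if ideal_order (v M) I = \<infinity> then \<infinity> else if enat n \<le> ideal_order (v M) I then 1 else 0)"
proof -
  interpret local_order_ring R M "v M" using local_order_ring M .
  let ?J = "level_ideal I n" and ?K = "localization_kernel R M"
  have J: "ideal ?J R" using level_ideal_radical by (simp add: radical_ideal_def)
  have "?J \<subseteq> ?K \<longleftrightarrow> ord I = \<infinity>"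
  proof
    assume "?J \<subseteq> ?K"
    then show "ord I = \<infinity>" using subset_level_ideal[OF I n] ord_infinity_iff[OF I] by blast
  next
    assume "ord I = \<infinity>"
    then have "I \<subseteq> localization_kernel R ?K"
      using ord_infinity_iff[OF I] localization_kernel_antimono[OF localization_kernel_subset[OF M.primeideal]]
      by blast
    then have "?K \<notin> supp I" using Supp_ideal_iff[OF I] by blast
    then show "?J \<subseteq> ?K" using kernel_prime by (auto simp: level_ideal_def Spec_def)
  qed
  moreover have "?J \<subseteq> M \<longleftrightarrow> enat n \<le> ord I" if fin: "ord I \<noteq> \<infinity>"
  proof
    assume "enat n \<le> ord I"
    then have "M \<in> V_pow R n I" using V_pow_supp_iff[OF I n, of M] M fin by blast
    then show "?J \<subseteq> M" using M.primeideal by (auto simp: level_ideal_def Spec_def)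
  next
    assume sub: "?J \<subseteq> M"
    show "enat n \<le> ord I"
    proof (rule ccontr)
      assume "\<not> enat n \<le> ord I"
      then have "M \<notin> V_pow R n I \<inter> supp I" using V_pow_supp_iff[OF I n, of M] by blast
      moreover have Msupp: "M \<in> supp I"
        using maximal_supp_iff[OF I M] fin by simp
      moreover obtain E where E: "E \<subseteq> carrier R"
        "V_pow R n I \<inter> supp I = {P \<in> Spec R. E \<subseteq> P} \<inter> supp I"
        using closed unfolding closedin_subtopology closedin_zariski by blast
      ultimately have "\<not> E \<subseteq> M" using M.primeideal unfolding Spec_def by blast
      then obtain e where e: "e \<in> E" "e \<in> carrier R" "e \<notin> M" using E by blast
      obtain x where x: "x \<in> I" "x \<in> carrier R" "x \<notin> ?K"
        using Msupp Supp_ideal_iff[OF I] ideal.Icarr[OF I] by blast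
      obtain y where y: "y \<in> carrier R - M"
        "\<And>z. z \<in> carrier R \<Longrightarrow> z \<otimes> x = \<zero> \<Longrightarrow> y \<otimes> z = \<zero>"
        using Supp_neighbourhood[OF bounded M x(2,3)] by blast
      have "e \<otimes> y \<in> P" if P: "P \<in> Spec R" "P \<in> supp I \<longrightarrow> P \<in> V_pow R n I" for P
      proof -
        interpret P: primeideal P R using P by (simp add: Spec_def)
        show ?thesis
        proof (cases "P \<in> supp I")
          case True
          then have "e \<in> P" using P E e by blast
          then show ?thesis using P.I_r_closed y by blast
        next
          case False
          then have "x \<in> localization_kernel R P"
            using Supp_ideal_iff[OF I] P.primeideal x(1) by blast
          then obtain u where u: "u \<in> carrier R" "u \<notin> P" "u \<otimes> x = \<zero>"
            by (auto simp: localization_kernel_def)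
          then have "y \<otimes> u = \<zero>" using y(2) by blast
          then have "y \<in> P" using P.I_prime[of y u] u y(1) P.zero_closed by auto
          then show ?thesis using P.I_l_closed e by blast
        qed
      qed
      then have "e \<otimes> y \<in> ?J" using e y by (simp add: level_ideal_def)
      then show False using sub M.I_prime[of e y] e y by blast
    qed
  qed
  ultimately show ?thesis using ord_radical[OF level_ideal_radical, of I n] by auto
qed

lemma sum_levels: "m \<le> N \<Longrightarrow>
  sum_list (map (\<lambda>n. if enat n \<le> enat m then 1 else 0) [1..<Suc N]) = enat m"
proof (induction N)
  case 0
  then show ?case by (simp add: zero_enat_def)
next
  case (Suc N)
  have all: "sum_list (map (\<lambda>n. if enat n \<le> enat m then 1 else 0) [1..<Suc k]) = enat k"
    if "k \<le> m" for k
    using that by (induction k) (simp_all add: zero_enat_def one_enat_def)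
  show ?case
  proof (cases "m = Suc N")
    case True
    then show ?thesis using all[of m] by simp
  next
    case False
    then show ?thesis using Suc by simp
  qed
qed

text \<open>
  If \<open>I\<close> has finite order \<open>m\<close> at \<open>M\<close>, exactly the levels \<open>1, \<dots>, m\<close> contribute 1 each to the order
  of the product; hence the product of all nonempty levels has the orders of \<open>I\<close> everywhere.
\<close>

lemma product_of_level_ideals:
  assumes bounded: "\<And>I. ideal I R \<Longrightarrow> \<exists>N. \<forall>n\<ge>N. V_pow R n I \<inter> supp I = {}"
    and closed: "\<And>n. n \<ge> 1 \<Longrightarrow>
      closedin (subtopology (zariski_topology R) (supp I)) (V_pow R n I \<inter> supp I)"
    and I: "ideal I R"
  shows "\<exists>Js. (\<forall>J\<in>set Js. radical_ideal J R) \<and> I = foldr (ideal_prod R) Js (carrier R)"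
proof -
  obtain N where N: "\<And>n. n \<ge> N \<Longrightarrow> V_pow R n I \<inter> supp I = {}" using bounded[OF I] by blast
  \<comment> \<open>The upper end \<open>Suc N\<close> guarantees at least one factor, so that the product vanishes wherever
    \<open>I\<close> does even if \<open>N = 0\<close>.\<close>
  define Js where "Js = map (level_ideal I) [1..<Suc (Suc N)]"
  have ideals: "\<forall>J\<in>set Js. ideal J R"
    using level_ideal_radical by (auto simp: Js_def radical_ideal_def)
  have "I = foldr (ideal_prod R) Js (carrier R)"
  proof (rule ideal_eqI[OF I foldr_ideal_prod_ideal[OF ideals]])
    fix M assume M: "maximalideal M R"
    interpret local_order_ring R M "v M" using local_order_ring M .
    have "map ord Js = map (\<lambda>n. if ord I = \<infinity> then \<infinity> else if enat n \<le> ord I then 1 else 0)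
        [1..<Suc (Suc N)]"
      unfolding Js_def map_map o_def
      by (rule map_cong[OF refl], rule ord_level_ideal[OF bounded closed I _ M]) auto
    moreover have "sum_list (map (\<lambda>n. if ord I = \<infinity> then \<infinity> else if enat n \<le> ord I then 1 else 0)
        [1..<Suc (Suc N)]) = ord I"
    proof (cases "ord I")
      case (enat m)
      have "m \<le> Suc N"
      proof (rule ccontr)
        assume "\<not> m \<le> Suc N"
        then have "M \<in> V_pow R m I \<inter> supp I" using V_pow_supp_iff[OF I, of m M] M enat by simp
        then show False using N[of m] \<open>\<not> m \<le> Suc N\<close> by simp
      qed
      then show ?thesis using sum_levels[of m "Suc N"] enat by simp
    qed (simp add: upt_rec[of 1])
    ultimately show "ord I = ord (foldr (ideal_prod R) Js (carrier R))"
      using ord_foldr_prod[OF ideals] by simp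
  qed
  then show ?thesis using level_ideal_radical by (intro exI[of _ Js]) (auto simp: Js_def)
qed

end

section \<open>The characterization of SSP-rings\<close>

theorem theorem3p7:
  fixes A :: "('a, 'm) ring_scheme"
  assumes "cring A"
    and "\<And>M. maximalideal M A \<Longrightarrow>
           discrete_valuation_domain (ring_localization A (carrier A - M))"
  shows "SSP_ring A \<longleftrightarrow>
    (\<forall>I. ideal I A \<longrightarrow>
       (\<forall>n\<ge>1. closedin (subtopology (zariski_topology A) (Supp A (ideal_module A I)))
                 (V_pow A n I \<inter> Supp A (ideal_module A I))) \<and>
       (\<exists>N. \<forall>n\<ge>N. V_pow A n I \<inter> Supp A (ideal_module A I) = {}))"
proof -
  interpret A: cring A by fact
  have "\<exists>v. local_order A M v" if "maximalideal M A" for M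
    using A.local_order_exists[OF A.maximalideal_prime[OF that] assms(2)[OF that]] .
  then obtain v where "\<And>M. maximalideal M A \<Longrightarrow> local_order A M (v M)" by metis
  then interpret locally_dvr A v
    by (intro locally_dvr.intro locally_dvr_axioms.intro local_order_ring.intro
        local_order_ring_axioms.intro assms(1))
  show ?thesis
  proof (intro iffI allI impI conjI)
    fix I and n :: nat assume "SSP_ring A" and I: "ideal I A" and n: "1 \<le> n"
    then obtain Js where Js: "\<forall>J\<in>set Js. radical_ideal J A" "I = foldr (ideal_prod A) Js (carrier A)"
      unfolding SSP_ring_def by blast
    have "\<forall>J\<in>set Js. J \<subseteq> carrier A"
      using Js(1) ideal.Icarr unfolding radical_ideal_def by fast
    then show "closedin (subtopology (zariski_topology A) (supp I)) (V_pow A n I \<inter> supp I)"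
      unfolding V_pow_supp_radical_product[OF I Js n] closedin_subtopology
      using A.closedin_count_containing by blast
  next
    fix I assume "SSP_ring A" and I: "ideal I A"
    then obtain Js where Js: "\<forall>J\<in>set Js. radical_ideal J A" "I = foldr (ideal_prod A) Js (carrier A)"
      unfolding SSP_ring_def by blast
    have "V_pow A n I \<inter> supp I = {}" if "n \<ge> Suc (length Js)" for n
    proof -
      have "\<not> n \<le> length (filter (\<lambda>J. J \<subseteq> P) Js)" for P
        using length_filter_le[of "\<lambda>J. J \<subseteq> P" Js] that by linarith
      then show ?thesis using V_pow_supp_radical_product[OF I Js, of n] that by simp
    qed
    then show "\<exists>N. \<forall>n\<ge>N. V_pow A n I \<inter> supp I = {}" by blast
  next
    assume "\<forall>I. ideal I A \<longrightarrow>
       (\<forall>n\<ge>1. closedin (subtopology (zariski_topology A) (supp I)) (V_pow A n I \<inter> supp I)) \<and>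
       (\<exists>N. \<forall>n\<ge>N. V_pow A n I \<inter> supp I = {})"
    then show "SSP_ring A"
      unfolding SSP_ring_def using assms(1) product_of_level_ideals by blast
  qed
qed

end
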